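(* Let $n\ge 1$. A map $Z:\mathcal{K}_n^n\to C(\mathbb{R}^n)$ is a continuous, positively $\mathrm{GL}(n)$ covariant and logarithmic translation covariant valuation if and only if there exists a constant $c\in\mathbb{R}$ such that $$ZK=c\,\mathcal{L}K$$ for every $K\in\mathcal{K}_n^n$.
   Context: $\mathcal{K}_n^n$ is the set of $n$-dimensional convex bodies in $\mathbb{R}^n$, i.e. compact convex subsets of $\mathbb{R}^n$ of dimension $n$ (nonempty interior). $C(\mathbb{R}^n)$ is the space of continuous real-valued functions on $\mathbb{R}^n$; we write $ZK(x)$ for the value of the function $ZK$ at $x$. The Laplace transform of $K\in\mathcal{K}_n^n$ is the function $\mathcal{L}K(x)=\int_K e^{-x\cdot y}\,dy$, $x\in\mathbb{R}^n$. Definitions for a map $Z:\mathcal{K}_n^n\to C(\mathbb{R}^n)$: - valuation: $Z(K\cup L)+Z(K\cap L)=ZK+ZL$ whenever $K,L,K\cup L,K\cap L\in\mathcal{K}_n^n$; - continuous: for every $x\in\mathbb{R}^n$, $ZK_i(x)\to ZK(x)$ whenever $K_i,K\in\mathcal{K}_n^n$ and $K_i\to K$ in the Hausdorff metric; - positively $\mathrm{GL}(n)$ covariant: $Z(\phi K)(x)=|\det\phi|\,ZK(\phi^t x)$ for all $K\in\mathcal{K}_n^n$, $x\in\mathbb{R}^n$ and all $\phi\in\mathrm{GL}(n)$ (real invertible $n\times n$ matrices) with positive determinant; - logarithmic translation covariant: $Z(K+t)(x)=e^{-t\cdot x}ZK(x)$ for all $K\in\mathcal{K}_n^n$ and $t,x\in\mathbb{R}^n$.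 *)

theory Defs
  imports "HOL-Analysis.Analysis"
begin

definition convex_bodies :: "'a::euclidean_space set set" where
  "convex_bodies = {K. compact K \<and> convex K \<and> interior K \<noteq> {}}"

text \<open>Only meaningful for nonempty bounded sets: otherwise the suprema are unspecified.\<close>

definition hausdorff_dist :: "'a::metric_space set \<Rightarrow> 'a set \<Rightarrow> real" where
  "hausdorff_dist K L = max (SUP x\<in>K. infdist x L) (SUP y\<in>L. infdist y K)"

definition laplace_transform :: "'a::euclidean_space set \<Rightarrow> 'a \<Rightarrow> real" where
  "laplace_transform K x = (LINT y:K|lborel. exp (- (x \<bullet> y)))"

text \<open>
  A map from the convex bodies to the continuous functions is encoded as a function
  \<open>Z\<close> on all sets whose values outside \<open>convex_bodies\<close> are irrelevant; all the
  properties below are relativised to \<open>convex_bodies\<close>.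
\<close>

definition valuation :: "('a::euclidean_space set \<Rightarrow> 'a \<Rightarrow> real) \<Rightarrow> bool" where
  "valuation Z \<longleftrightarrow>
    (\<forall>K L. K \<in> convex_bodies \<longrightarrow> L \<in> convex_bodies \<longrightarrow>
       K \<union> L \<in> convex_bodies \<longrightarrow> K \<inter> L \<in> convex_bodies \<longrightarrow>
       (\<forall>x. Z (K \<union> L) x + Z (K \<inter> L) x = Z K x + Z L x))"

definition hausdorff_continuous :: "('a::euclidean_space set \<Rightarrow> 'a \<Rightarrow> real) \<Rightarrow> bool" where
  "hausdorff_continuous Z \<longleftrightarrow>
    (\<forall>x (Ks :: nat \<Rightarrow> 'a set) K.
       (\<forall>i. Ks i \<in> convex_bodies) \<longrightarrow> K \<in> convex_bodies \<longrightarrow>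
       (\<lambda>i. hausdorff_dist (Ks i) K) \<longlonglongrightarrow> 0 \<longrightarrow>
       (\<lambda>i. Z (Ks i) x) \<longlonglongrightarrow> Z K x)"

definition positively_GL_covariant ::
    "((real ^ 'n) set \<Rightarrow> real ^ 'n \<Rightarrow> real) \<Rightarrow> bool" where
  "positively_GL_covariant Z \<longleftrightarrow>
    (\<forall>K\<in>convex_bodies. \<forall>x. \<forall>\<phi> :: real ^ 'n ^ 'n. invertible \<phi> \<longrightarrow> det \<phi> > 0 \<longrightarrow>
       Z ((\<lambda>y. \<phi> *v y) ` K) x = \<bar>det \<phi>\<bar> * Z K (transpose \<phi> *v x))"

definition log_translation_covariant ::
    "('a::euclidean_space set \<Rightarrow> 'a \<Rightarrow> real) \<Rightarrow> bool" where
  "log_translation_covariant Z \<longleftrightarrow>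
    (\<forall>K\<in>convex_bodies. \<forall>t x. Z ((\<lambda>y. y + t) ` K) x = exp (- (t \<bullet> x)) * Z K x)"

end

(* Write H+ and H- for the half-spaces of a hyperplane H through the interior of K. The valuation
property for K cut by H and by a parallel copy of H at distance e shows that
Z(K inter H+) + Z(K inter H-) - Z K is the limit of Z on the strips of K of width e. If x is not
normal to H, then stretching by 1/e in a direction orthogonal to x but transversal to H fixes x,
turns the strips into bodies converging to a prism and costs a factor e, so this limit vanishes;
the remaining x follow from continuity in x. Hence Z is additive under dissections.

Let T be the standard simplex. Subtracting a multiple of the Laplace transform one may assume
Z T 0 = 0. Dissect a polytope into simplices A T + a of small diameter with det A > 0. By
covariance the value at x on such a simplex is det A * exp (- a.x) * Z T (A^t x), that is, its volume
times a bounded factor times a value of Z T close to 0. So Z vanishes on polytopes, and on all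
convex bodies by continuity. *)

theory Submission
  imports Defs
begin

text \<open>The valuation identity needs \<open>K \<inter> L\<close> to have interior, so by itself
  it says nothing about a cut along a hyperplane; the thin overlap is the way around this. Moreover
  cuts come one hyperplane at a time, whereas a triangulation is in general not produced by
  successive cuts of the polytope. The bridge is a defect functional, the value on a set minus the
  sum of the values on its pieces in the cells: it is again additive under cuts, and it vanishes on
  convex sets inside a single cell. No functional equation has to be solved: covariance moves the
  argument to A^t x, which is close to 0 as soon as the simplex is small, whatever its shape, so the
  single number Z T 0 controls everything. Continuity in x is thus used at 0, at normals of H, and
  in dimension one. Since covariance is restricted to positive determinants, every simplex has to be
  an orientation preserving image of T; an orientation reversing affine symmetry of T makes this
  possible.\<close>

subsection \<open>Covariance of the Laplace transform\<close>

text \<open>The library has this formula only for well-ordered index types.\<close>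

lemma lmeasurable_linear_image:
  fixes f :: "real^'n \<Rightarrow> real^'n"
  assumes "linear f" "S \<in> lmeasurable"
  shows "f ` S \<in> lmeasurable \<and> measure lebesgue (f ` S) = \<bar>det (matrix f)\<bar> * measure lebesgue S"
proof -
  define P :: "(real^'n \<Rightarrow> real^'n) \<Rightarrow> bool" where
    "P g \<longleftrightarrow> (\<forall>S\<in>lmeasurable. g ` S \<in> lmeasurable \<and>
        measure lebesgue (g ` S) = \<bar>det (matrix g)\<bar> * measure lebesgue S)" for g
  have "P f"
  proof (rule induct_linear_elementary [OF \<open>linear f\<close>])
    fix g h :: "real^'n \<Rightarrow> real^'n"
    assume "linear g" "linear h" "P g" "P h"
    then show "P (g \<circ> h)"
      unfolding P_def image_comp[symmetric] by (simp add: matrix_compose det_mul abs_mult)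
  next
    fix g :: "real^'n \<Rightarrow> real^'n" and i
    assume g: "linear g" and 0: "\<And>x. g x $ i = 0"
    have "\<not> inj g"
    proof
      assume "inj g"
      then have "surj g" using g linear_injective_imp_surjective by blast
      then obtain y where "g y = axis i 1" by (metis surjD)
      with 0[of y] show False by simp
    qed
    then have "negligible (g ` S)" "det (matrix g) = 0" for S
      using g negligible_linear_singular_image[OF g] det_nz_iff_inj[OF g] by auto
    then show "P g"
      by (simp add: P_def negligible_iff_measure)
  next
    fix c :: "'n \<Rightarrow> real"
    have "det (matrix (\<lambda>x::real^'n. \<chi> i. c i * x $ i)) = prod c UNIV"
      by (subst det_diagonal) (auto simp: matrix_def axis_def)
    then show "P (\<lambda>x. \<chi> i. c i * x $ i)"
      by (simp add: P_def measurable_stretch measure_stretch)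
  next
    fix m n :: 'n
    assume "m \<noteq> n"
    let ?t = "Transposition.transpose m n"
    let ?h = "\<lambda>x::real^'n. \<chi> i. x $ ?t i"
    have lin: "linear ?h"
      by (rule linearI) (simp_all add: vec_eq_iff)
    have "matrix ?h = (\<chi> i. mat 1 $ ?t i)"
      by (auto simp: matrix_def mat_def axis_def vec_eq_iff)
    then have d: "\<bar>det (matrix ?h)\<bar> = 1"
      using det_permute_rows[of ?t "mat 1 :: real^'n^'n"]
      by (simp add: permutes_swap_id sign_swap_id \<open>m \<noteq> n\<close>)
    have "measure lebesgue (?h ` cbox a b) = 1 * measure lebesgue (cbox a b)" for a b :: "real^'n"
    proof (cases "cbox a b = {}")
      case False
      have eq: "?h ` cbox a b = cbox (?h a) (?h b)"
        by (auto simp: image_iff lambda_swap_Galois mem_box_cart) (metis transpose_involutory)+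
      then have "cbox (?h a) (?h b) \<noteq> {}" using False by auto
      then show ?thesis
        using False prod.permute[OF permutes_swap_id[of m UNIV n], of "\<lambda>i. b $ i - a $ i"]
        by (simp add: eq content_cbox_cart o_def)
    qed simp
    then have "?h ` S \<in> lmeasurable \<and> measure lebesgue (?h ` S) = measure lebesgue S"
      if "S \<in> lmeasurable" for S
      using measure_linear_sufficient[OF lin that, of 1] unfolding mult_1 by (blast intro: sym)
    then show "P ?h"
      by (simp add: P_def d)
  next
    fix m n :: 'n
    assume "m \<noteq> n"
    let ?h = "\<lambda>x::real^'n. \<chi> i. if i = m then x $ m + x $ n else x $ i"
    have lin: "linear ?h"
      by (rule linearI) (auto simp: vec_eq_iff algebra_simps)
    have "matrix ?h = (\<chi> k. if k = m then row m (mat 1) + 1 *s row n (mat 1) else row k (mat 1))"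
      by (auto simp: matrix_def mat_def axis_def vec_eq_iff row_def)
    then have d: "det (matrix ?h) = 1"
      using det_row_operation[OF \<open>m \<noteq> n\<close>, of "mat 1 :: real^'n^'n" 1] by simp
    have "measure lebesgue (?h ` cbox a b) = 1 * measure lebesgue (cbox a b)" for a b :: "real^'n"
    proof (cases "cbox a b = {}")
      case False
      \<comment> \<open>\<open>measure_shear_interval\<close> asks for a lower corner with
        nonnegative coordinate \<open>n\<close>, so the box is first translated to have its lower
        corner at 0.\<close>
      have ne: "cbox 0 (b - a) \<noteq> {}"
        using False by (simp add: interval_ne_empty_cart)
      have tr: "cbox a b = (+) a ` cbox 0 (b - a)"
        using cbox_translation[of a 0 "b - a"] by simp
      have "?h ` cbox a b = (+) (?h a) ` (?h ` cbox 0 (b - a))"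
        unfolding tr by (simp only: image_image linear_add[OF lin])
      then have "measure lebesgue (?h ` cbox a b) = measure lebesgue (?h ` cbox 0 (b - a))"
        by (simp only: measure_translation)
      also have "\<dots> = measure lebesgue (cbox 0 (b - a))"
        using \<open>m \<noteq> n\<close> ne by (subst measure_shear_interval) auto
      also have "\<dots> = measure lebesgue (cbox a b)"
        by (simp only: tr measure_translation)
      finally show ?thesis by simp
    qed simp
    then have "?h ` S \<in> lmeasurable \<and> measure lebesgue (?h ` S) = measure lebesgue S"
      if "S \<in> lmeasurable" for S
      using measure_linear_sufficient[OF lin that, of 1] unfolding mult_1 by (blast intro: sym)
    then show "P ?h"
      by (simp add: P_def d)
  qed
  with assms show ?thesis by (simp add: P_def)
qed

text \<open>A Borel measure that gives every box its volume is \<open>lborel\<close>, so only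
  preimages of boxes have to be measured. These are images under the inverse \<open>B\<close>, and
  |det A| |det B| = 1. In this form the formula can be substituted directly into an
  integral.\<close>

lemma lborel_invertible_matrix:
  fixes A :: "real^'n^'n"
  assumes "invertible A"
  shows "lborel = density (distr lborel borel ((*v) A)) (\<lambda>_. ennreal \<bar>det A\<bar>)"
proof (rule lborel_eqI)
  fix l u :: "real^'n"
  assume le: "\<And>b. b \<in> Basis \<Longrightarrow> l \<bullet> b \<le> u \<bullet> b"
  obtain B where B: "A ** B = mat 1" "B ** A = mat 1"
    using assms by (auto simp: invertible_def)
  have [measurable]: "((*v) A) \<in> borel \<rightarrow>\<^sub>M borel"
    by (intro borel_measurable_continuous_onI) (simp add: linear_continuous_on matrix_vector_mul_bounded_linear)
  have vi: "(*v) A -` box l u = (*v) B ` box l u"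
    using B by (force simp: image_iff matrix_vector_mul_assoc intro!: bexI[where x="A *v _"])
  have "open ((*v) A -` box l u)"
    by (intro continuous_open_vimage) (auto simp: continuous_on_eq_continuous_at matrix_vector_mult_linear_continuous_at)
  then have "(*v) B ` box l u \<in> sets lborel"
    using vi by simp
  then have "emeasure lborel ((*v) B ` box l u) = emeasure lebesgue ((*v) B ` box l u)"
    by simp
  also have "\<dots> = ennreal (measure lebesgue ((*v) B ` box l u))"
    using lmeasurable_linear_image[of "(*v) B" "box l u"] by (intro emeasure_eq_measure2) simp
  also have "\<dots> = ennreal (\<bar>det B\<bar> * measure lebesgue (box l u))"
    using lmeasurable_linear_image[of "(*v) B" "box l u"] by simp
  finally have e: "emeasure lborel ((*v) A -` box l u) = ennreal (\<bar>det B\<bar> * (\<Prod>b\<in>Basis. (u - l) \<bullet> b))"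
    using le by (simp add: vi measure_lborel_box_eq inner_diff_left)
  have "\<bar>det A\<bar> * \<bar>det B\<bar> = 1"
    using B by (metis abs_mult abs_one det_I det_mul)
  then have [simp]: "\<bar>det A\<bar> * (\<bar>det B\<bar> * p) = p" for p :: real
    by (metis mult.assoc mult_1)
  show "emeasure (density (distr lborel borel ((*v) A)) (\<lambda>_. ennreal \<bar>det A\<bar>)) (box l u)
      = ennreal (\<Prod>b\<in>Basis. (u - l) \<bullet> b)"
    by (simp add: emeasure_density emeasure_distr nn_integral_cmult e ennreal_mult'[symmetric] nn_integral_cmult_indicator)
qed simp

lemma laplace_transform_matrix_image:
  fixes A :: "real^'n^'n"
  assumes "invertible A" "compact K"
  shows "laplace_transform ((*v) A ` K) x = \<bar>det A\<bar> * laplace_transform K (transpose A *v x)"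
proof -
  have cont: "continuous_on S ((*v) A)" for S
    by (simp add: linear_continuous_on matrix_vector_mul_bounded_linear)
  then have [measurable]: "((*v) A) \<in> borel \<rightarrow>\<^sub>M borel"
    by (intro borel_measurable_continuous_onI)
  have "compact ((*v) A ` K)"
    by (intro compact_continuous_image cont assms)
  then have [measurable]: "(*v) A ` K \<in> sets borel" "K \<in> sets borel"
    using assms by (auto intro: borel_compact)
  have [simp]: "indicat_real ((*v) A ` K) (A *v y) = indicat_real K y" for y
    using inj_matrix_vector_mult[OF assms(1)] by (auto simp: indicator_def inj_def)
  have "laplace_transform ((*v) A ` K) x
    = (\<integral>y. indicator ((*v) A ` K) y * exp (- (x \<bullet> y))
        \<partial>density (distr lborel borel ((*v) A)) (\<lambda>_. ennreal \<bar>det A\<bar>))"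
    using lborel_invertible_matrix[OF assms(1)]
    by (simp add: laplace_transform_def set_lebesgue_integral_def)
  also have "\<dots> = (\<integral>y. \<bar>det A\<bar> * (indicator K y * exp (- (x \<bullet> (A *v y)))) \<partial>lborel)"
    by (subst integral_density) (auto simp: integral_distr)
  finally show ?thesis
    by (simp add: laplace_transform_def set_lebesgue_integral_def dot_lmul_matrix)
qed

lemma laplace_transform_translation:
  fixes K :: "'a::euclidean_space set"
  assumes "compact K"
  shows "laplace_transform ((\<lambda>y. y + t) ` K) x = exp (- (t \<bullet> x)) * laplace_transform K x"
proof -
  have "compact ((\<lambda>y. y + t) ` K)"
    using compact_translation[OF assms, of t] by (simp add: add.commute)
  then have [measurable]: "(\<lambda>y. y + t) ` K \<in> sets borel" "K \<in> sets borel"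
    using assms by (auto intro: borel_compact)
  have [simp]: "indicat_real ((\<lambda>y. y + t) ` K) (y + t) = indicat_real K y" for y
    by (auto simp: indicator_def)
  have "laplace_transform ((\<lambda>y. y + t) ` K) x
    = (\<integral>y. indicator ((\<lambda>y. y + t) ` K) y * exp (- (x \<bullet> y)) \<partial>distr lborel borel ((+) t))"
    by (simp add: laplace_transform_def set_lebesgue_integral_def lborel_distr_plus)
  also have "\<dots> = (\<integral>y. exp (- (t \<bullet> x)) * (indicator K y * exp (- (x \<bullet> y))) \<partial>lborel)"
    by (subst integral_distr) (auto simp: inner_add_right exp_add inner_commute mult_ac exp_minus exp_diff field_simps intro!: Bochner_Integration.integral_cong)
  finally show ?thesis
    by (simp add: laplace_transform_def set_lebesgue_integral_def)
qed

subsection \<open>Hausdorff convergence of convex bodies\<close>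

text \<open>Reduces Hausdorff convergence to statements about single points. By compactness, points
  of \<open>Ks i\<close> staying away from \<open>K\<close> would have a cluster point, which
  \<open>outer\<close> puts into \<open>K\<close>. Conversely a finite subset of \<open>D\<close> is
  an e/2-net of \<open>K\<close>, and by \<open>inner\<close> it eventually lies in
  \<open>Ks i\<close>. Only a dense \<open>D\<close> is tested because boundary points of
  \<open>K\<close> may belong to no \<open>Ks i\<close> at all.\<close>

lemma hausdorff_dist_tendsto_0:
  fixes Ks :: "nat \<Rightarrow> 'a::heine_borel set"
  assumes Ks: "\<And>i. Ks i \<subseteq> B" "bounded B" and K: "compact K" "K \<noteq> {}"
    and D: "D \<subseteq> K" "K \<subseteq> closure D"
    and inner: "\<And>y. y \<in> D \<Longrightarrow> \<forall>\<^sub>F i in sequentially. y \<in> Ks i"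
    and outer: "\<And>y r l. strict_mono (r :: nat \<Rightarrow> nat) \<Longrightarrow> (\<And>i. y i \<in> Ks (r i)) \<Longrightarrow> y \<longlonglongrightarrow> l \<Longrightarrow> l \<in> K"
  shows "(\<lambda>i. hausdorff_dist (Ks i) K) \<longlonglongrightarrow> 0"
proof (rule LIMSEQ_I)
  fix e :: real
  assume "e > 0"
  then have "e / 2 > 0" by simp
  have up: "\<forall>\<^sub>F i in sequentially. \<forall>y\<in>Ks i. infdist y K \<le> e / 2"
  proof (rule ccontr)
    assume "\<not> ?thesis"
    then have "\<exists>\<^sub>F i in sequentially. \<exists>y\<in>Ks i. infdist y K > e / 2"
      by (simp add: not_eventually not_le)
    then have "infinite {i. \<exists>y\<in>Ks i. infdist y K > e / 2}"
      unfolding cofinite_eq_sequentially[symmetric] frequently_cofinite .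
    from infinite_enumerate[OF this]
    obtain r :: "nat \<Rightarrow> nat" where r: "strict_mono r" "\<And>i. \<exists>y\<in>Ks (r i). infdist y K > e / 2"
      by blast
    then obtain y where y: "\<And>i. y i \<in> Ks (r i)" "\<And>i. infdist (y i) K > e / 2" by metis
    have "compact (closure B)" using \<open>bounded B\<close> by simp
    moreover have "\<forall>i. y i \<in> closure B" using y(1) Ks(1) closure_subset by blast
    ultimately obtain l s where s: "strict_mono (s :: nat \<Rightarrow> nat)" "(y \<circ> s) \<longlonglongrightarrow> l"
      unfolding compact_def by metis
    have "l \<in> K"
      by (rule outer[of "r \<circ> s" "y \<circ> s"]) (use r s y in \<open>auto simp: strict_mono_o\<close>)
    moreover have "e / 2 \<le> infdist l K"
      by (rule LIMSEQ_le_const[OF tendsto_infdist[OF s(2)]]) (use y(2) less_imp_le in \<open>auto simp: o_def\<close>)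
    ultimately show False using \<open>e > 0\<close> by simp
  qed
  have "K \<subseteq> (\<Union>d\<in>D. ball d (e / 2))"
  proof
    fix y assume "y \<in> K"
    then have "y \<in> closure D" using D by blast
    then obtain d where "d \<in> D" "dist d y < e / 2"
      using \<open>e / 2 > 0\<close> unfolding closure_approachable by blast
    then show "y \<in> (\<Union>d\<in>D. ball d (e / 2))" by auto
  qed
  then obtain F where F: "F \<subseteq> D" "finite F" "K \<subseteq> (\<Union>d\<in>F. ball d (e / 2))"
    using compactE_image[OF K(1), of D "\<lambda>d. ball d (e / 2)"] by (metis open_ball)
  have "\<forall>\<^sub>F i in sequentially. \<forall>d\<in>F. d \<in> Ks i"
    using F inner by (auto simp: eventually_ball_finite_distrib)
  then have "\<forall>\<^sub>F i in sequentially. norm (hausdorff_dist (Ks i) K - 0) < e"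
    using up
  proof eventually_elim
    case (elim i)
    have low: "infdist y (Ks i) \<le> e / 2" if "y \<in> K" for y
    proof -
      obtain d where "d \<in> F" "dist d y < e / 2"
        using subsetD[OF F(3) \<open>y \<in> K\<close>] unfolding UN_iff mem_ball by blast
      then show ?thesis
        using elim(1) by (intro infdist_le2[of d]) (auto simp: dist_commute)
    qed
    \<comment> \<open>A supremum over the empty set is unspecified, so a point of \<open>K\<close>
      is used to see that \<open>Ks i\<close> is nonempty; it also shows that the second supremum is
      nonnegative.\<close>
    obtain k where k: "k \<in> K" using K by blast
    then have "F \<noteq> {}" using F by auto
    then have "Ks i \<noteq> {}" using elim(1) by auto
    then have "(SUP x\<in>Ks i. infdist x K) \<le> e / 2" "(SUP y\<in>K. infdist y (Ks i)) \<le> e / 2"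
      using elim(2) low K(2) by (blast intro: cSUP_least)+
    moreover have "0 \<le> (SUP y\<in>K. infdist y (Ks i))"
      using low by (intro cSUP_upper2[OF _ k infdist_nonneg] bdd_aboveI2[where M = "e / 2"])
    ultimately show ?case
      using \<open>e > 0\<close> by (auto simp: hausdorff_dist_def)
  qed
  then show "\<exists>N. \<forall>i\<ge>N. norm (hausdorff_dist (Ks i) K - 0) < e"
    by (simp add: eventually_sequentially)
qed

lemma infdist_le_hausdorff_dist:
  assumes "bounded K" "bounded L" "K \<noteq> {}" "L \<noteq> {}"
  shows "x \<in> K \<Longrightarrow> infdist x L \<le> hausdorff_dist K L"
    and "y \<in> L \<Longrightarrow> infdist y K \<le> hausdorff_dist K L"
proof -
  have bdd: "bdd_above ((\<lambda>x. infdist x S) ` T)" if "bounded T" "S \<noteq> {}" for S T :: "'a set"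
  proof -
    obtain s where s: "s \<in> S" using \<open>S \<noteq> {}\<close> by blast
    obtain e where e: "\<And>x. x \<in> T \<Longrightarrow> dist s x \<le> e" using \<open>bounded T\<close> bounded_any_center[of T s] by blast
    show ?thesis
      by (rule bdd_aboveI2[of _ _ e]) (use s e in \<open>auto intro!: infdist_le2 simp: dist_commute\<close>)
  qed
  show "x \<in> K \<Longrightarrow> infdist x L \<le> hausdorff_dist K L"
    unfolding hausdorff_dist_def using bdd[of K L] assms
    by (intro max.coboundedI1 cSUP_upper) auto
  show "y \<in> L \<Longrightarrow> infdist y K \<le> hausdorff_dist K L"
    unfolding hausdorff_dist_def using bdd[of L K] assms
    by (intro max.coboundedI2 cSUP_upper) auto
qed

lemma convex_bodiesD:
  assumes "K \<in> convex_bodies"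
  shows "compact K" "convex K" "interior K \<noteq> {}" "closed K" "bounded K" "K \<noteq> {}"
  using assms by (auto simp: convex_bodies_def compact_imp_closed compact_imp_bounded)

context
  fixes Ks :: "nat \<Rightarrow> 'a::euclidean_space set" and K :: "'a set"
  assumes Ks: "\<And>i. Ks i \<in> convex_bodies" and K: "K \<in> convex_bodies"
    and lim: "(\<lambda>i. hausdorff_dist (Ks i) K) \<longlonglongrightarrow> 0"
begin

text \<open>Convexity of \<open>Ks i\<close> is essential: a point \<open>y\<close> missed by
  \<open>Ks i\<close> is cut off by a hyperplane, and then a whole half of the ball around
  \<open>y\<close> is missed, whose farthest point has distance at least \<open>r\<close> from
  \<open>Ks i\<close>.\<close>

lemma hausdorff_limit_interior:
  assumes "y \<in> interior K"
  shows "\<forall>\<^sub>F i in sequentially. y \<in> Ks i"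
proof -
  obtain r where r: "r > 0" "cball y r \<subseteq> K"
    using assms by (auto simp: mem_interior_cball)
  have "\<forall>\<^sub>F i in sequentially. hausdorff_dist (Ks i) K < r"
    using order_tendstoD(2)[OF lim] r by simp
  then show ?thesis
  proof eventually_elim
    case (elim i)
    note Ki = convex_bodiesD[OF Ks[of i]]
    show ?case
    proof (rule ccontr)
      assume "y \<notin> Ks i"
      then obtain a b where ab: "a \<bullet> y < b" "\<And>x. x \<in> Ks i \<Longrightarrow> b < a \<bullet> x"
        using separating_hyperplane_closed_point[OF Ki(2) Ki(4)] by metis
      obtain w where "w \<in> Ks i" using Ki by blast
      then have "a \<noteq> 0" using ab by fastforce
      \<comment> \<open>The point of the ball around \<open>y\<close> that lies deepest on the far
        side of the separating hyperplane, as seen from \<open>Ks i\<close>.\<close>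
      define z where "z = y - (r / norm a) *\<^sub>R a"
      have "z \<in> K" using r \<open>a \<noteq> 0\<close> by (auto simp: z_def dist_norm)
      have az: "a \<bullet> z = a \<bullet> y - r * norm a"
        using \<open>a \<noteq> 0\<close> by (simp add: z_def inner_diff_right power2_norm_eq_inner[symmetric] power2_eq_square)
      have "r \<le> dist z x" if "x \<in> Ks i" for x
      proof -
        have "r * norm a < a \<bullet> (x - z)"
          using ab(1) ab(2)[OF that] az by (simp add: inner_diff_right)
        also have "\<dots> \<le> norm a * norm (x - z)" by (rule norm_cauchy_schwarz)
        finally show ?thesis
          using \<open>a \<noteq> 0\<close> by (simp add: dist_norm norm_minus_commute mult.commute)
      qed
      then have "r \<le> infdist z (Ks i)"
        using Ki(6) by (simp add: infdist_notempty cINF_greatest)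
      also have "\<dots> \<le> hausdorff_dist (Ks i) K"
        using infdist_le_hausdorff_dist(2)[OF Ki(5) convex_bodiesD(5)[OF K] Ki(6)] \<open>z \<in> K\<close> by blast
      finally show False using elim by simp
    qed
  qed
qed

lemma hausdorff_limit_exterior:
  assumes "y \<notin> K"
  shows "\<forall>\<^sub>F i in sequentially. y \<notin> Ks i"
proof -
  note K' = convex_bodiesD[OF K]
  have "infdist y K > 0"
    using assms K' infdist_pos_not_in_closed by blast
  then have "\<forall>\<^sub>F i in sequentially. hausdorff_dist (Ks i) K < infdist y K"
    using order_tendstoD(2)[OF lim] by simp
  then show ?thesis
  proof eventually_elim
    case (elim i)
    then show ?case
      using infdist_le_hausdorff_dist(1)[OF convex_bodiesD(5)[OF Ks] K'(5) convex_bodiesD(6)[OF Ks] K'(6), of y i]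
      by (auto simp: not_less[symmetric])
  qed
qed

lemma hausdorff_limit_bounded:
  obtains R where "\<forall>\<^sub>F i in sequentially. Ks i \<subseteq> cball 0 R"
proof -
  note K' = convex_bodiesD[OF K]
  obtain R where R: "K \<subseteq> cball 0 R" using bounded_subset_ballD[OF K'(5)] ball_subset_cball by blast
  have "\<forall>\<^sub>F i in sequentially. hausdorff_dist (Ks i) K < 1"
    using order_tendstoD(2)[OF lim] by simp
  then have "\<forall>\<^sub>F i in sequentially. Ks i \<subseteq> cball 0 (R + 1)"
  proof eventually_elim
    case (elim i)
    show ?case
    proof
      fix y assume "y \<in> Ks i"
      then have "infdist y K < 1"
        using infdist_le_hausdorff_dist(1)[OF convex_bodiesD(5)[OF Ks] K'(5) convex_bodiesD(6)[OF Ks] K'(6), of y i] elim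
        by simp
      then obtain k where "k \<in> K" "dist y k < 1"
        using K'(6) by (metis infdist_attains_inf K'(4))
      then show "y \<in> cball 0 (R + 1)"
        using R norm_triangle_sub[of y k] by (force simp: dist_norm)
    qed
  qed
  then show thesis by (rule that)
qed

text \<open>Dominated convergence: the indicators converge at interior points and at exterior points
  of \<open>K\<close>, and the frontier of a convex set is null.\<close>

lemma laplace_transform_tendsto:
  "(\<lambda>i. laplace_transform (Ks i) x) \<longlonglongrightarrow> laplace_transform K x"
proof -
  obtain R where "\<forall>\<^sub>F i in sequentially. Ks i \<subseteq> cball 0 R"
    using hausdorff_limit_bounded .
  \<comment> \<open>The dominating function must work for every index, so the sequence is shifted
    past the members that may leave the ball.\<close>
  then obtain N where N: "\<And>i. Ks (i + N) \<subseteq> cball 0 R"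
    by (metis eventually_sequentially le_add2)
  have [measurable]: "Ks i \<in> sets borel" "K \<in> sets borel" for i
    using Ks K by (simp_all add: convex_bodiesD(4))
  have "AE y in lebesgue. y \<notin> frontier K"
    using negligible_convex_frontier[OF convex_bodiesD(2)[OF K]]
    by (intro AE_not_in) (simp add: negligible_iff_null_sets)
  then have fr: "AE y in lborel. y \<notin> frontier K"
    by (subst (asm) AE_completion_iff) auto
  have "(\<lambda>i. laplace_transform (Ks (i + N)) x) \<longlonglongrightarrow> laplace_transform K x"
    unfolding laplace_transform_def set_lebesgue_integral_def
  proof (rule integral_dominated_convergence)
    show "integrable lborel (\<lambda>y. indicat_real (cball 0 R) y *\<^sub>R exp (norm x * R))"
      using emeasure_compact_finite[OF compact_cball] by (simp add: integrable_indicator_iff less_top)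
    show "AE y in lborel. (\<lambda>i. indicat_real (Ks (i + N)) y *\<^sub>R exp (- (x \<bullet> y)))
        \<longlonglongrightarrow> indicat_real K y *\<^sub>R exp (- (x \<bullet> y))"
      using fr
    proof eventually_elim
      case (elim y)
      have "\<forall>\<^sub>F i in sequentially. indicat_real (Ks i) y = indicat_real K y"
      proof (cases "y \<in> K")
        case True
        then have "y \<in> interior K"
          using elim closure_subset by (auto simp: frontier_def)
        from hausdorff_limit_interior[OF this] show ?thesis
          by eventually_elim (use True in auto)
      next
        case False
        from hausdorff_limit_exterior[OF this] show ?thesis
          by eventually_elim (use False in auto)
      qed
      then have "(\<lambda>i. indicat_real (Ks i) y) \<longlonglongrightarrow> indicat_real K y"
        by (rule tendsto_eventually)
      then have "(\<lambda>i. indicat_real (Ks (i + N)) y) \<longlonglongrightarrow> indicat_real K y"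
        by (rule LIMSEQ_ignore_initial_segment)
      then show ?case by (intro tendsto_intros)
    qed
    show "AE y in lborel. norm (indicat_real (Ks (i + N)) y *\<^sub>R exp (- (x \<bullet> y)))
        \<le> indicat_real (cball 0 R) y *\<^sub>R exp (norm x * R)" for i
    proof (intro AE_I2)
      fix y
      have "- (x \<bullet> y) \<le> norm x * R" if "y \<in> cball 0 R"
      proof -
        have "- (x \<bullet> y) \<le> norm x * norm y"
          using Cauchy_Schwarz_ineq2[of x y] by linarith
        also have "\<dots> \<le> norm x * R" using that by (intro mult_left_mono) auto
        finally show ?thesis .
      qed
      then show "norm (indicat_real (Ks (i + N)) y *\<^sub>R exp (- (x \<bullet> y)))
        \<le> indicat_real (cball 0 R) y *\<^sub>R exp (norm x * R)"
        using N[of i] by (auto simp: indicator_def)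
    qed
  qed measurable
  then show ?thesis by (rule LIMSEQ_offset)
qed

end

section \<open>Valuation property and continuity in the argument of the Laplace transform\<close>

lemma integrable_exp_inner:
  assumes "compact K"
  shows "set_integrable lborel K (\<lambda>y. exp (- (x \<bullet> y)))"
  unfolding set_integrable_def by (intro borel_integrable_compact assms continuous_intros)

lemma laplace_transform_valuation:
  assumes "compact K" "compact L"
  shows "laplace_transform (K \<union> L) x + laplace_transform (K \<inter> L) x
    = laplace_transform K x + laplace_transform L x"
proof -
  note i = integrable_exp_inner[of _ x, unfolded set_integrable_def]
  have "laplace_transform (K \<union> L) x + laplace_transform (K \<inter> L) x
      = (\<integral>y. indicat_real (K \<union> L) y *\<^sub>R exp (- (x \<bullet> y)) + indicat_real (K \<inter> L) y *\<^sub>R exp (- (x \<bullet> y)) \<partial>lborel)"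
    unfolding laplace_transform_def set_lebesgue_integral_def
    by (rule Bochner_Integration.integral_add[symmetric]; rule i) (use assms in auto)
  also have "\<dots> = (\<integral>y. indicat_real K y *\<^sub>R exp (- (x \<bullet> y)) + indicat_real L y *\<^sub>R exp (- (x \<bullet> y)) \<partial>lborel)"
    by (intro Bochner_Integration.integral_cong) (auto simp: indicator_def)
  also have "\<dots> = laplace_transform K x + laplace_transform L x"
    unfolding laplace_transform_def set_lebesgue_integral_def
    by (rule Bochner_Integration.integral_add; rule i) (use assms in auto)
  finally show ?thesis .
qed

lemma continuous_laplace_transform:
  assumes "compact K"
  shows "continuous_on UNIV (laplace_transform K)"
  unfolding continuous_on_sequentially
proof (intro allI ballI impI, elim conjE)
  fix a and xs :: "nat \<Rightarrow> 'a"
  assume xs: "xs \<longlonglongrightarrow> a"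
  obtain R where R: "K \<subseteq> cball 0 R" using bounded_subset_ballD[OF compact_imp_bounded[OF assms]] ball_subset_cball by blast
  obtain M where M: "\<And>i. norm (xs i) \<le> M"
    using xs convergent_imp_Bseq[of xs] by (auto simp: convergent_def Bseq_def)
  have [measurable]: "K \<in> sets borel" using assms borel_compact by blast
  have "(\<lambda>i. laplace_transform K (xs i)) \<longlonglongrightarrow> laplace_transform K a"
    unfolding laplace_transform_def set_lebesgue_integral_def
  proof (rule integral_dominated_convergence)
    show "integrable lborel (\<lambda>y. indicat_real K y *\<^sub>R exp (M * R))"
      using emeasure_compact_finite[OF assms] by (simp add: integrable_indicator_iff less_top)
    show "AE y in lborel. (\<lambda>i. indicat_real K y *\<^sub>R exp (- (xs i \<bullet> y)))
        \<longlonglongrightarrow> indicat_real K y *\<^sub>R exp (- (a \<bullet> y))"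
      by (intro AE_I2 tendsto_intros xs)
    show "AE y in lborel. norm (indicat_real K y *\<^sub>R exp (- (xs i \<bullet> y)))
        \<le> indicat_real K y *\<^sub>R exp (M * R)" for i
    proof (intro AE_I2)
      fix y
      have "- (xs i \<bullet> y) \<le> M * R" if "y \<in> K"
      proof -
        have "- (xs i \<bullet> y) \<le> norm (xs i) * norm y"
          using Cauchy_Schwarz_ineq2[of "xs i" y] by linarith
        also have "\<dots> \<le> M * R"
          using that R M[of i] order_trans[OF norm_ge_zero M] by (intro mult_mono) auto
        finally show ?thesis .
      qed
      then show "norm (indicat_real K y *\<^sub>R exp (- (xs i \<bullet> y))) \<le> indicat_real K y *\<^sub>R exp (M * R)"
        by (auto simp: indicator_def)
    qed
  qed measurable
  then show "(laplace_transform K \<circ> xs) \<longlonglongrightarrow> laplace_transform K a"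
    by (simp add: o_def)
qed

subsection \<open>Thin strips of a convex body\<close>

lemma convex_bodies_Int:
  assumes "K \<in> convex_bodies" "closed H" "convex H" "interior K \<inter> interior H \<noteq> {}"
  shows "K \<inter> H \<in> convex_bodies"
  using assms by (auto simp: convex_bodies_def convex_Int compact_Int_closed)

lemma convex_bodies_matrix_image:
  fixes A :: "real^'n^'n"
  assumes "K \<in> convex_bodies" "invertible A"
  shows "(*v) A ` K \<in> convex_bodies"
proof -
  have "interior ((*v) A ` K) = (*v) A ` interior K"
    using assms(2) by (intro interior_injective_linear_image) (auto simp: inj_matrix_vector_mult)
  then show ?thesis
    using assms(1) by (auto simp: convex_bodies_def convex_linear_image
        intro!: compact_continuous_image matrix_vector_mult_linear_continuous_on)
qed

lemma convex_bodies_translation: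
  assumes "K \<in> convex_bodies"
  shows "(\<lambda>y. y + t) ` K \<in> convex_bodies"
proof -
  have "(\<lambda>y. y + t) ` K = (+) t ` K" by (simp add: add.commute)
  then show ?thesis
    using assms by (auto simp: convex_bodies_def interior_translation compact_translation convex_translation)
qed

text \<open>If \<open>u \<bullet> v = 1\<close>, this is the linear map that fixes the hyperplane
  orthogonal to \<open>u\<close> pointwise and multiplies \<open>v\<close> by \<open>e\<close>.
  Keeping \<open>v\<close> separate from the normal \<open>u\<close> leaves room to choose
  \<open>v\<close> orthogonal to the argument x of Z.\<close>

definition axis_scale :: "'a::real_inner \<Rightarrow> 'a \<Rightarrow> real \<Rightarrow> 'a \<Rightarrow> 'a" where
  "axis_scale u v e y = y + ((e - 1) * (u \<bullet> y)) *\<^sub>R v"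

lemma linear_axis_scale: "linear (axis_scale u v e)"
  by (rule linearI) (simp_all add: axis_scale_def inner_add_right algebra_simps)

lemma axis_scale_scale:
  assumes "u \<bullet> v = 1"
  shows "axis_scale u v d (axis_scale u v e y) = axis_scale u v (d * e) y"
    and "u \<bullet> axis_scale u v e y = e * (u \<bullet> y)"
    and "axis_scale u v e v = e *\<^sub>R v"
  using assms by (simp_all add: axis_scale_def inner_add_right algebra_simps)

lemma axis_scale_1 [simp]: "axis_scale u v 1 = id"
  by (auto simp: axis_scale_def)

text \<open>The maps are multiplicative in \<open>e\<close>. Hence the determinant at
  \<open>e\<close> is the square of the one at \<open>sqrt e\<close>, and it is nonzero because
  \<open>1 / e\<close> gives the inverse.\<close>

lemma det_axis_scale_pos:
  fixes u v :: "real^'n"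
  assumes "u \<bullet> v = 1" "e > 0"
  shows "det (matrix (axis_scale u v e)) > 0"
proof -
  let ?M = "\<lambda>e. matrix (axis_scale u v e)"
  have mult: "det (?M (d * e)) = det (?M d) * det (?M e)" for d e
  proof -
    have "axis_scale u v (d * e) = axis_scale u v d \<circ> axis_scale u v e"
      using axis_scale_scale(1)[OF assms(1)] by auto
    then show ?thesis
      by (simp add: matrix_compose linear_axis_scale det_mul)
  qed
  have "det (?M e) * det (?M (1 / e)) = 1"
    using mult[of e "1 / e"] assms(2) by (simp add: matrix_id_mat_1)
  then have "det (?M e) \<noteq> 0" by auto
  moreover have "det (?M e) = (det (?M (sqrt e)))\<^sup>2"
    using mult[of "sqrt e" "sqrt e"] assms(2) by (simp add: power2_eq_square)
  ultimately show ?thesis by simp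
qed

text \<open>The determinant is a polynomial in \<open>e\<close>, and at 0 the map is singular
  because it kills \<open>v\<close>.\<close>

lemma det_axis_scale_tendsto_0:
  fixes u v :: "real^'n"
  assumes "u \<bullet> v = 1" "e \<longlonglongrightarrow> 0"
  shows "(\<lambda>i. det (matrix (axis_scale u v (e i)))) \<longlonglongrightarrow> 0"
proof -
  have *: "matrix (axis_scale u v d) $ i $ j = of_bool (i = j) + (d - 1) * (u $ j) * (v $ i)" for d i j
    by (simp add: matrix_def axis_scale_def inner_axis) (simp add: axis_def)
  have "(\<lambda>i. det (matrix (axis_scale u v (e i)))) \<longlonglongrightarrow> det (matrix (axis_scale u v 0))"
    unfolding det_def * by (intro tendsto_intros assms)
  moreover have "\<not> inj (axis_scale u v 0)"
    using axis_scale_scale(3)[OF assms(1), of 0] assms(1) linear_0[OF linear_axis_scale]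
    by (metis injD inner_zero_right scale_zero_left zero_neq_one)
  then have "det (matrix (axis_scale u v 0)) = 0"
    using det_nz_iff_inj[OF linear_axis_scale] by blast
  ultimately show ?thesis by simp
qed

text \<open>For \<open>v \<bullet> x = 0\<close> the right-hand side is \<open>x\<close>: covariance
  then stretches the body without moving the argument.\<close>

lemma transpose_axis_scale:
  fixes u v x :: "real^'n"
  shows "transpose (matrix (axis_scale u v e)) *v x = x + ((e - 1) * (v \<bullet> x)) *\<^sub>R u"
proof -
  have "(transpose (matrix (axis_scale u v e)) *v x) \<bullet> y = (x + ((e - 1) * (v \<bullet> x)) *\<^sub>R u) \<bullet> y" for y
    by (simp add: dot_lmul_matrix matrix_works linear_axis_scale)
      (simp add: axis_scale_def inner_add_left inner_add_right inner_commute)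
  then show ?thesis using vector_eq_rdot by blast
qed

text \<open>For \<open>e > 0\<close> this is the strip of \<open>K\<close> of width \<open>e\<close> below \<open>p\<close>, moved to the origin and
  stretched by \<open>1 / e\<close> along \<open>v\<close>; for \<open>e = 0\<close> it is the limit of these bodies.\<close>

definition scaled_slab :: "'a::euclidean_space set \<Rightarrow> 'a \<Rightarrow> 'a \<Rightarrow> 'a \<Rightarrow> real \<Rightarrow> 'a set" where
  "scaled_slab K p u v e = {y. -1 \<le> u \<bullet> y \<and> u \<bullet> y \<le> 0 \<and> p + axis_scale u v e y \<in> K}"

context
  fixes K :: "'a::euclidean_space set" and p u v :: 'a
  assumes K: "K \<in> convex_bodies" and p: "p \<in> interior K" and uv: "u \<bullet> v = 1"
begin

lemma eventually_interior_segment: "\<forall>\<^sub>F s in at_right 0. p - (s * c) *\<^sub>R v \<in> interior K"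
proof -
  have "((\<lambda>s. p - (s * c) *\<^sub>R v) \<longlongrightarrow> p - (0 * c) *\<^sub>R v) (at_right 0)"
    by (intro tendsto_intros)
  from topological_tendstoD[OF this open_interior] p show ?thesis by simp
qed

text \<open>This covers \<open>e = 0\<close>, where \<open>axis_scale\<close> is singular and
  preimages of bounded sets need not be bounded. The constraints on \<open>u \<bullet> y\<close>
  help: the difference between \<open>y\<close> and its image under \<open>axis_scale\<close> is a
  multiple of \<open>v\<close> whose factor is at most |e - 1| in absolute value.\<close>

lemma scaled_slab_body:
  "scaled_slab K p u v e \<in> convex_bodies"
proof -
  let ?f = "\<lambda>y. p + axis_scale u v e y"
  have f: "continuous_on UNIV ?f"
    by (auto simp: axis_scale_def intro!: continuous_intros)
  have eq: "scaled_slab K p u v e = {y. -1 \<le> u \<bullet> y} \<inter> {y. u \<bullet> y \<le> 0} \<inter> ?f -` K"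
    by (auto simp: scaled_slab_def)
  have "closed (?f -` K)"
    using continuous_closed_vimage[OF convex_bodiesD(4)[OF K]] f
    by (metis UNIV_I continuous_on_eq_continuous_at open_UNIV)
  then have "closed (scaled_slab K p u v e)"
    unfolding eq by (intro closed_Int closed_halfspace_le closed_halfspace_ge)
  moreover have "bounded (scaled_slab K p u v e)"
  proof -
    obtain R where R: "\<And>y. y \<in> K \<Longrightarrow> norm y \<le> R"
      using convex_bodiesD(5)[OF K] by (auto simp: bounded_iff)
    have "norm y \<le> R + norm p + \<bar>e - 1\<bar> * norm v" if "y \<in> scaled_slab K p u v e" for y
    proof -
      have "y = ?f y - p - ((e - 1) * (u \<bullet> y)) *\<^sub>R v"
        by (simp add: axis_scale_def)
      also have "norm \<dots> \<le> norm (?f y) + norm p + norm (((e - 1) * (u \<bullet> y)) *\<^sub>R v)"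
        by (meson norm_triangle_ineq4 norm_triangle_le_diff order_trans add_right_mono)
      also have "norm (((e - 1) * (u \<bullet> y)) *\<^sub>R v) \<le> (\<bar>e - 1\<bar> * 1) * norm v"
        unfolding norm_scaleR abs_mult
        using that by (intro mult_right_mono mult_left_mono) (auto simp: scaled_slab_def)
      finally show ?thesis
        using that R[of "?f y"] by (simp add: scaled_slab_def)
    qed
    then show ?thesis by (auto simp: bounded_iff)
  qed
  moreover have "convex (?f -` K)"
  proof (rule convexI)
    fix y z and a b :: real
    assume *: "y \<in> ?f -` K" "z \<in> ?f -` K" "0 \<le> a" "0 \<le> b" "a + b = 1"
    have "?f (a *\<^sub>R y + b *\<^sub>R z) = (a + b) *\<^sub>R p + a *\<^sub>R axis_scale u v e y + b *\<^sub>R axis_scale u v e z"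
      using *(5) by (simp add: linear_add linear_scale linear_axis_scale)
    also have "\<dots> = a *\<^sub>R ?f y + b *\<^sub>R ?f z"
      by (simp add: algebra_simps)
    also have "\<dots> \<in> K"
      using * convexD[OF convex_bodiesD(2)[OF K]] by auto
    finally show "a *\<^sub>R y + b *\<^sub>R z \<in> ?f -` K" by simp
  qed
  then have "convex (scaled_slab K p u v e)"
    unfolding eq by (intro convex_Int convex_halfspace_le convex_halfspace_ge)
  moreover have "interior (scaled_slab K p u v e) \<noteq> {}"
  proof -
    let ?O = "{y. -1 < u \<bullet> y} \<inter> {y. u \<bullet> y < 0} \<inter> ?f -` interior K"
    have "open (?f -` interior K)"
      using open_vimage[OF open_interior f] .
    then have "open ?O"
      by (intro open_Int open_halfspace_lt open_halfspace_gt)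
    moreover have "?O \<subseteq> scaled_slab K p u v e"
      using interior_subset[of K] by (auto simp: scaled_slab_def)
    \<comment> \<open>The witness for the interior is \<open>- s *\<^sub>R v\<close> with small s:
      its image \<open>p - (s * e) *\<^sub>R v\<close> stays close to the interior point
      \<open>p\<close>.\<close>
    moreover have "\<forall>\<^sub>F s in at_right 0. (0::real) < s \<and> s < 1"
      using eventually_at_right[of 0 1] by (auto intro!: eventually_at_rightI[of 0 1])
    then have "\<forall>\<^sub>F s in at_right 0. - s *\<^sub>R v \<in> ?O"
      using eventually_interior_segment[of e]
    proof eventually_elim
      case (elim s)
      have "?f (- s *\<^sub>R v) = p - (s * e) *\<^sub>R v"
        using axis_scale_scale(3)[OF uv, of e] linear_scale[OF linear_axis_scale, of u v e "-s" v] by simp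
      then show ?case using elim uv by auto
    qed
    then have "?O \<noteq> {}"
      using eventually_happens'[OF trivial_limit_at_right_real] by blast
    ultimately show ?thesis
      by (metis interior_maximal subset_empty)
  qed
  ultimately show ?thesis
    by (simp add: convex_bodies_def compact_eq_bounded_closed)
qed

lemma scaled_slab_tendsto:
  assumes "e \<longlonglongrightarrow> 0" "\<And>i. 0 \<le> e i" "\<And>i. e i \<le> 1"
  shows "(\<lambda>i. hausdorff_dist (scaled_slab K p u v (e i)) (scaled_slab K p u v 0)) \<longlonglongrightarrow> 0"
proof -
  obtain R where R: "\<And>y. y \<in> K \<Longrightarrow> norm y \<le> R"
    using convex_bodiesD(5)[OF K] by (auto simp: bounded_iff)
  \<comment> \<open>Having the image in the interior of \<open>K\<close> is stable under a small
    change of \<open>e\<close>; having it merely in \<open>K\<close> is not.\<close>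
  define D where "D = {y. -1 \<le> u \<bullet> y \<and> u \<bullet> y \<le> 0 \<and> p + axis_scale u v 0 y \<in> interior K}"
  have lim: "(\<lambda>i. p + axis_scale u v (d i) (y i)) \<longlonglongrightarrow> p + axis_scale u v 0 l"
    if "d \<longlonglongrightarrow> 0" "y \<longlonglongrightarrow> l" for d y l
    unfolding axis_scale_def using that by (intro tendsto_intros)
  show ?thesis
  proof (rule hausdorff_dist_tendsto_0[where D = D and B = "cball 0 (R + norm p + norm v)"])
    show "scaled_slab K p u v (e i) \<subseteq> cball 0 (R + norm p + norm v)" for i
    proof
      fix y assume y: "y \<in> scaled_slab K p u v (e i)"
      let ?f = "p + axis_scale u v (e i) y"
      have "y = ?f - p - ((e i - 1) * (u \<bullet> y)) *\<^sub>R v"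
        by (simp add: axis_scale_def)
      also have "norm \<dots> \<le> norm ?f + norm p + norm (((e i - 1) * (u \<bullet> y)) *\<^sub>R v)"
        by (meson norm_triangle_ineq4 norm_triangle_le_diff order_trans add_right_mono)
      also have "\<bar>e i - 1\<bar> * \<bar>u \<bullet> y\<bar> \<le> 1 * 1"
        using y assms(2,3)[of i] by (intro mult_mono) (auto simp: scaled_slab_def)
      then have "norm (((e i - 1) * (u \<bullet> y)) *\<^sub>R v) \<le> norm v"
        by (simp add: abs_mult mult_left_le_one_le)
      finally show "y \<in> cball 0 (R + norm p + norm v)"
        using y R[of ?f] by (simp add: scaled_slab_def)
    qed
    show "compact (scaled_slab K p u v 0)" "scaled_slab K p u v 0 \<noteq> {}"
      using convex_bodiesD[OF scaled_slab_body] by auto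
    show "D \<subseteq> scaled_slab K p u v 0"
      using interior_subset[of K] by (auto simp: D_def scaled_slab_def)
    show "scaled_slab K p u v 0 \<subseteq> closure D"
    proof
      fix y assume y: "y \<in> scaled_slab K p u v 0"
      \<comment> \<open>Shrinking \<open>y\<close> towards 0 shrinks its image towards the interior
        point \<open>p\<close>, hence moves it into the interior, and preserves both bounds on
        \<open>u \<bullet> y\<close>. This gives density of \<open>D\<close>.\<close>
      define t :: "nat \<Rightarrow> real" where "t i = inverse (Suc i)" for i
      have "t \<longlonglongrightarrow> 0" unfolding t_def by (rule LIMSEQ_inverse_real_of_nat)
      have t: "0 < t i" "t i \<le> 1" for i by (auto simp: t_def divide_simps)
      have "(\<lambda>i. (1 - t i) *\<^sub>R y) \<longlonglongrightarrow> (1 - 0) *\<^sub>R y"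
        by (intro tendsto_intros \<open>t \<longlonglongrightarrow> 0\<close>)
      moreover have "(1 - t i) *\<^sub>R y \<in> D" for i
      proof -
        have "(p + axis_scale u v 0 y) - t i *\<^sub>R (p + axis_scale u v 0 y - p) \<in> interior K"
          using y t by (intro mem_interior_convex_shrink[OF convex_bodiesD(2)[OF K] p]) (auto simp: scaled_slab_def)
        also have "(p + axis_scale u v 0 y) - t i *\<^sub>R (p + axis_scale u v 0 y - p)
            = p + axis_scale u v 0 ((1 - t i) *\<^sub>R y)"
          by (simp add: axis_scale_def algebra_simps)
        finally have "p + axis_scale u v 0 ((1 - t i) *\<^sub>R y) \<in> interior K" .
        moreover have "- 1 \<le> (1 - t i) * (u \<bullet> y)" "(1 - t i) * (u \<bullet> y) \<le> 0"
          using y t[of i] mult_left_le_one_le[of "- (u \<bullet> y)" "1 - t i"]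
          by (auto simp: scaled_slab_def mult_le_0_iff)
        ultimately show ?thesis by (simp add: D_def)
      qed
      ultimately show "y \<in> closure D"
        unfolding closure_sequential by (intro exI[of _ "\<lambda>i. (1 - t i) *\<^sub>R y"]) simp
    qed
    show "\<forall>\<^sub>F i in sequentially. y \<in> scaled_slab K p u v (e i)" if "y \<in> D" for y
    proof -
      have "\<forall>\<^sub>F i in sequentially. p + axis_scale u v (e i) y \<in> interior K"
        using topological_tendstoD[OF lim[OF assms(1) tendsto_const] open_interior] that
        by (simp add: D_def)
      then show ?thesis
        by eventually_elim (use that interior_subset[of K] in \<open>auto simp: D_def scaled_slab_def\<close>)
    qed
    show "l \<in> scaled_slab K p u v 0"
      if r: "strict_mono (r :: nat \<Rightarrow> nat)" and y: "\<And>i. y i \<in> scaled_slab K p u v (e (r i))" and l: "y \<longlonglongrightarrow> l" for r y l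
    proof -
      have "(e \<circ> r) \<longlonglongrightarrow> 0" using assms(1) r by (rule LIMSEQ_subseq_LIMSEQ)
      then have "p + axis_scale u v 0 l \<in> K"
        by (intro closed_sequentially[OF convex_bodiesD(4)[OF K] _ lim[OF _ l]]) (use y in \<open>auto simp: scaled_slab_def\<close>)
      moreover have "(\<lambda>i. u \<bullet> y i) \<longlonglongrightarrow> u \<bullet> l" by (intro tendsto_intros l)
      then have "- 1 \<le> u \<bullet> l" "u \<bullet> l \<le> 0"
        using y by (auto simp: scaled_slab_def intro: LIMSEQ_le_const LIMSEQ_le_const2)
      ultimately show ?thesis by (simp add: scaled_slab_def)
    qed
  qed simp
qed

lemma strip_eq_scaled_slab:
  assumes "e > 0"
  shows "K \<inter> {y. u \<bullet> p - e \<le> u \<bullet> y} \<inter> {y. u \<bullet> y \<le> u \<bullet> p} = (\<lambda>y. y + p) ` axis_scale u v e ` scaled_slab K p u v e"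
    (is "?S = ?T")
proof
  show "?T \<subseteq> ?S"
  proof (unfold image_image, rule image_subsetI)
    fix y assume y: "y \<in> scaled_slab K p u v e"
    then have "e * (- 1) \<le> e * (u \<bullet> y)" "e * (u \<bullet> y) \<le> 0"
      using assms mult_left_mono[of "- 1" "u \<bullet> y" e] by (auto simp: scaled_slab_def mult_le_0_iff)
    then show "axis_scale u v e y + p \<in> ?S"
      using y axis_scale_scale(2)[OF uv, of e y]
      by (simp add: scaled_slab_def inner_add_right add.commute)
  qed
  show "?S \<subseteq> ?T"
  proof
    fix z assume z: "z \<in> ?S"
    define y where "y = axis_scale u v (1 / e) (z - p)"
    have *: "axis_scale u v e y = z - p"
      using assms axis_scale_scale(1)[OF uv] by (simp add: y_def)
    have "u \<bullet> y = (u \<bullet> z - u \<bullet> p) / e"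
      using axis_scale_scale(2)[OF uv] by (simp add: y_def inner_diff_right)
    then have "- 1 \<le> u \<bullet> y" "u \<bullet> y \<le> 0"
      using z assms by (simp_all add: pos_le_divide_eq divide_le_0_iff)
    then have "y \<in> scaled_slab K p u v e"
      using z * by (simp add: scaled_slab_def)
    then have "(axis_scale u v e y) + p \<in> ?T" by blast
    then show "z \<in> ?T" by (simp add: *)
  qed
qed

end

lemma convex_bodies_Int_halfspace:
  assumes K: "K \<in> convex_bodies" and p: "p \<in> interior K" and u: "u \<noteq> 0"
  shows "K \<inter> {y. u \<bullet> y \<le> u \<bullet> p} \<in> convex_bodies" and "K \<inter> {y. u \<bullet> p \<le> u \<bullet> y} \<in> convex_bodies"
proof -
  have le: "K \<inter> {y. w \<bullet> y \<le> w \<bullet> p} \<in> convex_bodies" if "w \<noteq> 0" for w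
  proof -
    have w: "w \<bullet> (w /\<^sub>R (w \<bullet> w)) = 1" using that by simp
    have "\<forall>\<^sub>F s in at_right 0. (0::real) < s"
      by (simp add: eventually_at_right_less)
    then have "\<forall>\<^sub>F s in at_right 0. p - (s * 1) *\<^sub>R (w /\<^sub>R (w \<bullet> w)) \<in> interior K \<inter> interior {y. w \<bullet> y \<le> w \<bullet> p}"
      using eventually_interior_segment[OF K p w, of 1]
      by eventually_elim (use that w in \<open>simp add: inner_diff_right\<close>)
    then have "interior K \<inter> interior {y. w \<bullet> y \<le> w \<bullet> p} \<noteq> {}"
      using eventually_happens'[OF trivial_limit_at_right_real] by blast
    then show ?thesis
      by (intro convex_bodies_Int K closed_halfspace_le convex_halfspace_le)
  qed
  show "K \<inter> {y. u \<bullet> y \<le> u \<bullet> p} \<in> convex_bodies" "K \<inter> {y. u \<bullet> p \<le> u \<bullet> y} \<in> convex_bodies"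
    using le[OF u] le[of "-u"] u by auto
qed

subsection \<open>Dissection by hyperplanes\<close>

lemma parallel_if_CARD_1:
  fixes u v y :: "real^'n"
  assumes "CARD('n) = 1" "u \<bullet> v = 1"
  shows "y = (u \<bullet> y) *\<^sub>R v"
proof -
  obtain k :: 'n where k: "UNIV = {k}"
    using assms(1) by (metis card_1_singletonE)
  then have i: "i = k" for i by (metis UNIV_I singletonD)
  have inner: "a \<bullet> b = a $ k * b $ k" for a b :: "real^'n"
    unfolding inner_vec_def k by simp
  have "u $ k * v $ k = 1"
    using assms(2) by (simp add: inner)
  then have "(u $ k * y $ k) * v $ k = y $ k"
    by (simp add: mult.commute mult.left_commute)
  then show ?thesis
    unfolding vec_eq_iff inner by (metis i vector_scaleR_component real_scaleR_def)
qed

text \<open>The hypotheses form a locale because the results are needed for several maps: the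
  Laplace transform is an instance, and so is Z minus a multiple of it.\<close>

locale covariant_valuation =
  fixes Z :: "(real^'n) set \<Rightarrow> real^'n \<Rightarrow> real"
  assumes continuous_value: "K \<in> convex_bodies \<Longrightarrow> continuous_on UNIV (Z K)"
    and continuous: "hausdorff_continuous Z"
    and GL_covariant: "positively_GL_covariant Z"
    and translation_covariant: "log_translation_covariant Z"
    and valuation: "valuation Z"
begin

lemma tendsto_value:
  assumes "K \<in> convex_bodies" "xs \<longlonglongrightarrow> x"
  shows "(\<lambda>i. Z K (xs i)) \<longlonglongrightarrow> Z K x"
  using continuous_value[OF assms(1)] assms(2)
  by (metis UNIV_I continuous_on_eq_continuous_at isCont_tendsto_compose open_UNIV)

lemma tendsto_body:
  assumes "\<And>i. Ks i \<in> convex_bodies" "K \<in> convex_bodies" "(\<lambda>i. hausdorff_dist (Ks i) K) \<longlonglongrightarrow> 0"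
  shows "(\<lambda>i. Z (Ks i) x) \<longlonglongrightarrow> Z K x"
  using continuous assms unfolding hausdorff_continuous_def by blast

lemma affine_image:
  assumes "K \<in> convex_bodies" "invertible A" "det A > 0" "(*v) A ` K \<in> convex_bodies"
  shows "Z ((\<lambda>y. y + t) ` (*v) A ` K) x = exp (- (t \<bullet> x)) * (det A * Z K (transpose A *v x))"
  using translation_covariant GL_covariant assms
  by (simp add: log_translation_covariant_def positively_GL_covariant_def)

text \<open>In dimension one no \<open>v\<close> is orthogonal to a nonzero \<open>x\<close>, but there all thin strips are scaled
  copies of one segment, so continuity in \<open>x\<close> suffices.\<close>

lemma strip_tendsto_0:
  assumes K: "K \<in> convex_bodies" and p: "p \<in> interior K" and uv: "u \<bullet> v = 1"
    and x: "v \<bullet> x = 0 \<or> CARD('n) = 1"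
    and e: "e \<longlonglongrightarrow> 0" "\<And>i. 0 < e i" "\<And>i. e i \<le> 1"
  shows "(\<lambda>i. Z (K \<inter> {y. u \<bullet> p - e i \<le> u \<bullet> y} \<inter> {y. u \<bullet> y \<le> u \<bullet> p}) x) \<longlonglongrightarrow> 0"
proof -
  note L = scaled_slab_body[OF K p uv]
  let ?L = "scaled_slab K p u v"
  define M where "M i = matrix (axis_scale u v (e i))" for i
  have Mv: "(*v) (M i) = axis_scale u v (e i)" for i
    by (simp add: M_def matrix_vector_mul linear_axis_scale)
  have dM: "det (M i) > 0" for i
    unfolding M_def by (rule det_axis_scale_pos[OF uv e(2)])
  have eq: "Z (K \<inter> {y. u \<bullet> p - e i \<le> u \<bullet> y} \<inter> {y. u \<bullet> y \<le> u \<bullet> p}) x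
      = exp (- (p \<bullet> x)) * (det (M i) * Z (?L (e i)) (transpose (M i) *v x))" for i
  proof -
    have "(*v) (M i) ` ?L (e i) \<in> convex_bodies"
      using dM[of i] by (intro convex_bodies_matrix_image L) (simp add: invertible_det_nz)
    then show ?thesis
      unfolding strip_eq_scaled_slab[OF K p uv e(2)] Mv[symmetric]
      using dM[of i] by (intro affine_image L) (auto simp: invertible_det_nz)
  qed
  \<comment> \<open>Which limit this is does not matter, since the determinant in front tends to
    0.\<close>
  have "\<exists>l. (\<lambda>i. Z (?L (e i)) (transpose (M i) *v x)) \<longlonglongrightarrow> l"
    using x
  proof
    assume "v \<bullet> x = 0"
    then have "transpose (M i) *v x = x" for i
      by (simp add: M_def transpose_axis_scale del: transpose_matrix_vector)
    moreover have "(\<lambda>i. Z (?L (e i)) x) \<longlonglongrightarrow> Z (?L 0) x"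
      using e by (intro tendsto_body L scaled_slab_tendsto[OF K p uv]) (auto intro: less_imp_le)
    ultimately show ?thesis
      by (auto simp del: transpose_matrix_vector)
  next
    assume 1: "CARD('n) = 1"
    note par = parallel_if_CARD_1[OF 1 uv]
    obtain r where r: "r > 0" "cball p r \<subseteq> K"
      using p by (auto simp: mem_interior_cball)
    have "(\<lambda>i. e i * norm v) \<longlonglongrightarrow> 0 * norm v" by (intro tendsto_intros e)
    then have "\<forall>\<^sub>F i in sequentially. e i * norm v < r"
      using r by (intro order_tendstoD(2)) auto
    \<comment> \<open>In dimension one the points in question are \<open>p\<close> plus a multiple
      of \<open>v\<close> of length at most \<open>e i * norm v\<close>. Once this is below
      \<open>r\<close> they all lie in the ball inside \<open>K\<close>, so only the bounds on
      \<open>u \<bullet> y\<close> remain, and these do not involve \<open>e i\<close>.\<close>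
    then have ev: "\<forall>\<^sub>F i in sequentially. ?L (e i) = ?L 0"
    proof eventually_elim
      case (elim i)
      have "p + axis_scale u v d y \<in> K" if "-1 \<le> u \<bullet> y" "u \<bullet> y \<le> 0" "0 \<le> d" "d \<le> e i" for d y
      proof -
        have "axis_scale u v d y = (u \<bullet> y) *\<^sub>R v + ((d - 1) * (u \<bullet> y)) *\<^sub>R v"
          unfolding axis_scale_def by (subst par[of y]) simp
        also have "\<dots> = ((u \<bullet> y) * d) *\<^sub>R v"
          by (simp add: algebra_simps)
        finally have "norm (axis_scale u v d y) = \<bar>u \<bullet> y\<bar> * d * norm v"
          using that by (simp add: abs_mult)
        also have "\<dots> \<le> 1 * e i * norm v"
          using that by (intro mult_right_mono mult_mono) auto
        finally have "p + axis_scale u v d y \<in> cball p r"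
          using elim by (simp add: dist_norm)
        then show ?thesis using r(2) by blast
      qed
      then show ?case
        using e(2)[of i] by (auto simp: scaled_slab_def)
    qed
    have "(\<lambda>i. transpose (M i) *v x) \<longlonglongrightarrow> x + ((0 - 1) * (v \<bullet> x)) *\<^sub>R u"
      unfolding M_def transpose_axis_scale by (intro tendsto_intros e)
    from tendsto_value[OF L this]
    have "(\<lambda>i. Z (?L 0) (transpose (M i) *v x)) \<longlonglongrightarrow> Z (?L 0) (x + ((0 - 1) * (v \<bullet> x)) *\<^sub>R u)" .
    then have "(\<lambda>i. Z (?L (e i)) (transpose (M i) *v x)) \<longlonglongrightarrow> Z (?L 0) (x + ((0 - 1) * (v \<bullet> x)) *\<^sub>R u)"
      by (rule Lim_transform_eventually) (use ev in \<open>auto elim: eventually_mono\<close>)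
    then show ?thesis by blast
  qed
  then obtain l where l: "(\<lambda>i. Z (?L (e i)) (transpose (M i) *v x)) \<longlonglongrightarrow> l" by blast
  have "(\<lambda>i. det (M i)) \<longlonglongrightarrow> 0"
    unfolding M_def by (rule det_axis_scale_tendsto_0[OF uv e(1)])
  then have "(\<lambda>i. exp (- (p \<bullet> x)) * (det (M i) * Z (?L (e i)) (transpose (M i) *v x)))
      \<longlonglongrightarrow> exp (- (p \<bullet> x)) * (0 * l)"
    by (intro tendsto_intros l)
  then show ?thesis by (simp add: eq)
qed

lemma dissect_transversal:
  assumes K: "K \<in> convex_bodies" and p: "p \<in> interior K" and uv: "u \<bullet> v = 1"
    and x: "v \<bullet> x = 0 \<or> CARD('n) = 1"
  shows "Z K x = Z (K \<inter> {y. u \<bullet> y \<le> u \<bullet> p}) x + Z (K \<inter> {y. u \<bullet> p \<le> u \<bullet> y}) x"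
proof -
  have u: "u \<noteq> 0" using uv by auto
  define e :: "nat \<Rightarrow> real" where "e i = inverse (Suc i)" for i
  have e: "e \<longlonglongrightarrow> 0" "0 < e i" "e i \<le> 1" for i
    unfolding e_def by (rule LIMSEQ_inverse_real_of_nat) (auto simp: divide_simps)
  let ?G = "\<lambda>i. {y. u \<bullet> p - e i \<le> u \<bullet> y}" and ?L = "{y. u \<bullet> y \<le> u \<bullet> p}" and ?H = "{y. u \<bullet> p \<le> u \<bullet> y}"
  have iL: "interior ?L = {y. u \<bullet> y < u \<bullet> p}"
    and iG: "interior (?G i) = {y. u \<bullet> p - e i < u \<bullet> y}" for i
    using u interior_halfspace_ge[of u "u \<bullet> p - e i"] by simp_all
  have small: "\<forall>\<^sub>F s in at_right 0. (0::real) < s \<and> s < c" if "c > 0" for c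
    using that by (auto intro!: eventually_at_rightI[of 0 c])
  have bL: "K \<inter> ?L \<in> convex_bodies" and bH: "K \<inter> ?H \<in> convex_bodies"
    using convex_bodies_Int_halfspace[OF K p u] by auto
  have bG: "K \<inter> ?G i \<in> convex_bodies" for i
  proof -
    have "p \<in> interior K \<inter> interior (?G i)"
      using p e(2)[of i] by (simp add: iG)
    then show ?thesis
      by (intro convex_bodies_Int K closed_halfspace_ge convex_halfspace_ge) blast
  qed
  \<comment> \<open>For small s > 0 the point \<open>p - s v\<close> is interior to \<open>K\<close>
    and lies strictly between the two hyperplanes.\<close>
  have bS: "K \<inter> ?G i \<inter> ?L \<in> convex_bodies" for i
  proof -
    have "\<forall>\<^sub>F s in at_right 0. p - (s * 1) *\<^sub>R v \<in> interior (K \<inter> ?G i) \<inter> interior ?L"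
      using small[OF e(2)[of i]] eventually_interior_segment[OF K p uv, of 1]
      by eventually_elim (use uv in \<open>auto simp: iL iG interior_Int inner_diff_right\<close>)
    then have "interior (K \<inter> ?G i) \<inter> interior ?L \<noteq> {}"
      using eventually_happens'[OF trivial_limit_at_right_real] by blast
    then show ?thesis
      by (intro convex_bodies_Int[OF bG] closed_halfspace_le convex_halfspace_le)
  qed
  have un: "(K \<inter> ?G i) \<union> (K \<inter> ?L) = K" for i
    using e(2)[of i] by auto
  have "(K \<inter> ?G i) \<inter> (K \<inter> ?L) = K \<inter> ?G i \<inter> ?L" for i by auto
  then have v: "Z K x + Z (K \<inter> ?G i \<inter> ?L) x = Z (K \<inter> ?G i) x + Z (K \<inter> ?L) x" for i
    using valuation[unfolded valuation_def, rule_format, of "K \<inter> ?G i" "K \<inter> ?L" x] K bG bL bS un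
    by simp
  have "(\<lambda>i. hausdorff_dist (K \<inter> ?G i) (K \<inter> ?H)) \<longlonglongrightarrow> 0"
  proof (rule hausdorff_dist_tendsto_0[where D = "K \<inter> ?H" and B = K])
    show "bounded K" "compact (K \<inter> ?H)" "K \<inter> ?H \<noteq> {}"
      using convex_bodiesD[OF K] convex_bodiesD[OF bH] by auto
    show "\<forall>\<^sub>F i in sequentially. y \<in> K \<inter> ?G i" if "y \<in> K \<inter> ?H" for y
    proof (intro always_eventually allI)
      fix i
      show "y \<in> K \<inter> ?G i" using that e(2)[of i] by simp
    qed
    show "l \<in> K \<inter> ?H"
      if r: "strict_mono (r :: nat \<Rightarrow> nat)" and y: "\<And>i. y i \<in> K \<inter> ?G (r i)" and l: "y \<longlonglongrightarrow> l" for r y l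
    proof -
      have "l \<in> K"
        using closed_sequentially[OF convex_bodiesD(4)[OF K] _ l] y by blast
      moreover have "u \<bullet> p - 0 \<le> u \<bullet> l"
      proof (rule LIMSEQ_le)
        show "(\<lambda>i. u \<bullet> p - (e \<circ> r) i) \<longlonglongrightarrow> u \<bullet> p - 0"
          by (intro tendsto_intros LIMSEQ_subseq_LIMSEQ[OF e(1) r])
        show "(\<lambda>i. u \<bullet> y i) \<longlonglongrightarrow> u \<bullet> l" by (intro tendsto_intros l)
      qed (use y in auto)
      ultimately show ?thesis by simp
    qed
    show "K \<inter> ?H \<subseteq> closure (K \<inter> ?H)" by (rule closure_subset)
  qed auto
  from tendsto_body[OF bG bH this]
  have "(\<lambda>i. Z (K \<inter> ?G i) x + Z (K \<inter> ?L) x - Z (K \<inter> ?G i \<inter> ?L) x) \<longlonglongrightarrow> Z (K \<inter> ?H) x + Z (K \<inter> ?L) x - 0"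
    by (intro tendsto_intros strip_tendsto_0[OF K p uv x e])
  moreover have "Z (K \<inter> ?G i) x + Z (K \<inter> ?L) x - Z (K \<inter> ?G i \<inter> ?L) x = Z K x" for i
    using v[of i] by simp
  ultimately show ?thesis
    by (simp add: LIMSEQ_const_iff)
qed

end

section \<open>Functionals additive under hyperplane cuts and their sums over cells\<close>

definition dissective :: "('a::euclidean_space set \<Rightarrow> real) \<Rightarrow> bool" where
  "dissective f \<longleftrightarrow>
    (\<forall>K. compact K \<longrightarrow> convex K \<longrightarrow> interior K = {} \<longrightarrow> f K = 0) \<and>
    (\<forall>K u a. compact K \<longrightarrow> convex K \<longrightarrow> u \<noteq> 0 \<longrightarrow>
      f K = f (K \<inter> {y. u \<bullet> y \<le> a}) + f (K \<inter> {y. a \<le> u \<bullet> y}))"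

lemma dissective_empty_interior:
  "dissective f \<Longrightarrow> compact K \<Longrightarrow> convex K \<Longrightarrow> interior K = {} \<Longrightarrow> f K = 0"
  and dissective_halfspace:
  "dissective f \<Longrightarrow> compact K \<Longrightarrow> convex K \<Longrightarrow> u \<noteq> 0 \<Longrightarrow>
    f K = f (K \<inter> {y. u \<bullet> y \<le> a}) + f (K \<inter> {y. a \<le> u \<bullet> y})"
  unfolding dissective_def by blast+

text \<open>Cut along the bounding hyperplanes one after the other. Each cut splits off a piece
  lying beyond one of them, which \<open>outside\<close> handles; what survives all cuts is the part
  inside the polyhedron.\<close>

lemma dissective_vanish_polyhedron:
  fixes f :: "'a::euclidean_space set \<Rightarrow> real"
  assumes f: "dissective f"
    and F: "finite F" "\<And>h. h \<in> F \<Longrightarrow> \<exists>u a. u \<noteq> 0 \<and> h = {y. u \<bullet> y \<le> a}"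
    and Q: "compact Q" "convex Q"
    and inside: "f (Q \<inter> \<Inter>F) = 0"
    and outside: "\<And>R u a. compact R \<Longrightarrow> convex R \<Longrightarrow> R \<subseteq> Q \<Longrightarrow> u \<noteq> 0 \<Longrightarrow> {y. u \<bullet> y \<le> a} \<in> F \<Longrightarrow>
      R \<subseteq> {y. a \<le> u \<bullet> y} \<Longrightarrow> f R = 0"
  shows "f Q = 0"
  using assms(2-)
proof (induction F arbitrary: Q rule: finite_induct)
  case empty
  then show ?case by simp
next
  case (insert h F)
  obtain u a where h: "u \<noteq> 0" "h = {y. u \<bullet> y \<le> a}" using insert.prems(1)[of h] by blast
  have c: "compact (Q \<inter> h)" "convex (Q \<inter> h)" "compact (Q \<inter> {y. a \<le> u \<bullet> y})" "convex (Q \<inter> {y. a \<le> u \<bullet> y})"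
    using insert.prems(2,3) h
    by (auto intro!: compact_Int_closed convex_Int closed_halfspace_le closed_halfspace_ge convex_halfspace_le convex_halfspace_ge)
  have "f (Q \<inter> h) = 0"
  proof (rule insert.IH[OF _ c(1,2)])
    show "f (Q \<inter> h \<inter> \<Inter>F) = 0" using insert.prems(4) by (simp add: Int_assoc)
    show "f R = 0"
      if "compact R" "convex R" "R \<subseteq> Q \<inter> h" "u \<noteq> 0" "{y. u \<bullet> y \<le> a} \<in> F" "R \<subseteq> {y. a \<le> u \<bullet> y}" for R u a
      using insert.prems(5)[OF that(1,2) _ that(4) _ that(6)] that(3,5) by blast
  qed (use insert.prems(1) in blast)
  moreover have "f (Q \<inter> {y. a \<le> u \<bullet> y}) = 0"
    using insert.prems(5)[OF c(3,4) _ h(1), of a] h(2) by auto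
  ultimately show ?case
    using dissective_halfspace[OF f insert.prems(2,3) h(1), of a] h(2) by simp
qed

text \<open>Remove one polyhedron \<open>P\<close> at a time by cutting along its bounding
  hyperplanes. A piece beyond such a hyperplane has interior disjoint from \<open>P\<close>, so its
  interior is covered by the other members. Their union is closed and a convex set with interior
  lies in the closure of its interior, so they cover the whole piece and induction applies.\<close>

lemma dissective_vanish_Union:
  fixes f :: "'a::euclidean_space set \<Rightarrow> real"
  assumes f: "dissective f"
    and J: "finite J" "\<And>P. P \<in> J \<Longrightarrow> polyhedron P"
    and vanish: "\<And>P Q. P \<in> J \<Longrightarrow> compact Q \<Longrightarrow> convex Q \<Longrightarrow> Q \<subseteq> P \<Longrightarrow> f Q = 0"
    and Q: "compact Q" "convex Q" "Q \<subseteq> \<Union>J"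
  shows "f Q = 0"
  using assms(2-)
proof (induction J arbitrary: Q rule: finite_induct)
  case empty
  then show ?case using dissective_empty_interior[OF f, of "{}"] by simp
next
  case (insert P J)
  obtain F where F: "finite F" "P = \<Inter>F" "\<And>h. h \<in> F \<Longrightarrow> \<exists>u a. u \<noteq> 0 \<and> h = {y. u \<bullet> y \<le> a}"
    using insert.prems(1)[of P] unfolding polyhedron_def by blast
  show ?case
  proof (rule dissective_vanish_polyhedron[OF f F(1,3) insert.prems(3,4)])
    show "f (Q \<inter> \<Inter>F) = 0"
    proof (rule insert.prems(2)[of P])
      have "closed P" "convex P"
        using insert.prems(1)[of P] polyhedron_imp_closed polyhedron_imp_convex by auto
      then show "compact (Q \<inter> \<Inter>F)" "convex (Q \<inter> \<Inter>F)"
        using insert.prems(3,4) unfolding F(2) by (auto intro: compact_Int_closed convex_Int)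
    qed (auto simp: F(2))
    fix R u a
    assume R: "compact R" "convex R" "R \<subseteq> Q" "u \<noteq> 0" "{y. u \<bullet> y \<le> a} \<in> F" "R \<subseteq> {y. a \<le> u \<bullet> y}"
    show "f R = 0"
    proof (cases "interior R = {}")
      case True
      then show ?thesis using dissective_empty_interior[OF f R(1,2)] by simp
    next
      case False
      have "closed (\<Union>J)"
        using insert.hyps(1) insert.prems(1) by (auto intro: polyhedron_imp_closed)
      have "interior R \<subseteq> {y. a < u \<bullet> y}"
        using interior_mono[OF R(6)] R(4) by simp
      moreover have "P \<subseteq> {y. u \<bullet> y \<le> a}" using F(2) R(5) by blast
      ultimately have "interior R \<inter> P = {}" by force
      then have "interior R \<subseteq> \<Union>J"
        using R(3) insert.prems(5) interior_subset[of R] by blast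
      then have "closure (interior R) \<subseteq> \<Union>J"
        using \<open>closed (\<Union>J)\<close> by (rule closure_minimal)
      then have "R \<subseteq> \<Union>J"
        using convex_closure_interior[OF R(2) False] closure_subset by blast
      then show ?thesis
        using insert.IH[OF _ _ R(1,2)] insert.prems(1,2) by blast
    qed
  qed
qed

text \<open>The defect \<open>g\<close> measures the failure of additivity on an arbitrary
  \<open>Q\<close>. As \<open>dissective\<close> speaks of all compact convex sets, flat and empty
  ones included, it passes from \<open>f\<close> to \<open>g\<close>. If \<open>Q\<close> lies in
  one cell \<open>S\<close>, then \<open>Q\<close> meets the other cells in sets without interior,
  so the sum reduces to \<open>f Q\<close> and \<open>g Q = 0\<close>. The covering of
  \<open>P\<close> by the cells then gives \<open>g P = 0\<close>.\<close>

lemma dissective_sum: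
  fixes f :: "'a::euclidean_space set \<Rightarrow> real"
  assumes f: "dissective f" and J: "finite J" "\<And>S. S \<in> J \<Longrightarrow> polytope S"
    and disj: "\<And>S S'. S \<in> J \<Longrightarrow> S' \<in> J \<Longrightarrow> S \<noteq> S' \<Longrightarrow> interior (S \<inter> S') = {}"
    and P: "compact P" "convex P" "P = \<Union>J"
  shows "f P = (\<Sum>S\<in>J. f S)"
proof -
  define g where "g Q = f Q - (\<Sum>S\<in>J. f (Q \<inter> S))" for Q
  have S: "compact S" "closed S" "convex S" if "S \<in> J" for S
    using J(2)[OF that] by (auto simp: polytope_imp_compact polytope_imp_closed polytope_imp_convex)
  have g: "dissective g"
    unfolding dissective_def
  proof (intro conjI allI impI)
    fix K :: "'a set" assume K: "compact K" "convex K" "interior K = {}"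
    then have "f (K \<inter> S) = 0" if "S \<in> J" for S
      using S[OF that] interior_mono[of "K \<inter> S" K]
      by (intro dissective_empty_interior[OF f] compact_Int_closed convex_Int) auto
    then show "g K = 0"
      using dissective_empty_interior[OF f K] by (simp add: g_def)
  next
    fix K :: "'a set" and u a assume K: "compact K" "convex K" "u \<noteq> (0::'a)"
    have "f (K \<inter> S) = f (K \<inter> {y. u \<bullet> y \<le> a} \<inter> S) + f (K \<inter> {y. a \<le> u \<bullet> y} \<inter> S)" if "S \<in> J" for S
      using dissective_halfspace[OF f compact_Int_closed[OF K(1) S(2)[OF that]] convex_Int[OF K(2) S(3)[OF that]] K(3), of a]
      by (simp add: Int_ac)
    then have "(\<Sum>S\<in>J. f (K \<inter> S))
        = (\<Sum>S\<in>J. f (K \<inter> {y. u \<bullet> y \<le> a} \<inter> S)) + (\<Sum>S\<in>J. f (K \<inter> {y. a \<le> u \<bullet> y} \<inter> S))"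
      by (simp add: sum.distrib)
    then show "g K = g (K \<inter> {y. u \<bullet> y \<le> a}) + g (K \<inter> {y. a \<le> u \<bullet> y})"
      using dissective_halfspace[OF f K, of a] by (simp add: g_def)
  qed
  have "g P = 0"
  proof (rule dissective_vanish_Union[OF g J(1) _ _ P(1,2)])
    show "polyhedron S" if "S \<in> J" for S using J(2)[OF that] by (rule polytope_imp_polyhedron)
    show "P \<subseteq> \<Union>J" using P(3) by simp
    fix S Q assume *: "S \<in> J" "compact Q" "convex Q" "Q \<subseteq> S"
    have "f (Q \<inter> S') = 0" if "S' \<in> J - {S}" for S'
    proof (rule dissective_empty_interior[OF f])
      have "interior (Q \<inter> S') \<subseteq> interior (S \<inter> S')" using * by (intro interior_mono) auto
      then show "interior (Q \<inter> S') = {}" using disj[of S S'] * that by auto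
    qed (use * S that in \<open>auto intro: compact_Int_closed convex_Int\<close>)
    then have "(\<Sum>S'\<in>J. f (Q \<inter> S')) = f (Q \<inter> S)"
      using J(1) *(1) by (simp add: sum.remove)
    then show "g Q = 0"
      using *(4) by (simp add: g_def Int_absorb2)
  qed
  moreover have "P \<inter> S = S" if "S \<in> J" for S using P(3) that by blast
  ultimately show ?thesis by (simp add: g_def)
qed

section \<open>Simplices as orientation preserving images of the standard simplex\<close>

lemma std_simplex_cart:
  "convex hull (insert 0 Basis) = {x::real^'n. (\<forall>i. 0 \<le> x $ i) \<and> (\<Sum>i\<in>UNIV. x $ i) \<le> 1}"
proof -
  have "(\<Sum>b\<in>Basis. x \<bullet> b) = (\<Sum>i\<in>UNIV. x $ i)" for x :: "real^'n"
    by (simp add: Basis_vec_def UNION_singleton_eq_range sum.reindex inj_def axis_eq_axis inner_axis)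
  moreover have "(\<forall>b\<in>Basis. 0 \<le> x \<bullet> b) \<longleftrightarrow> (\<forall>i. 0 \<le> x $ i)" for x :: "real^'n"
    by (auto simp: Basis_vec_def inner_axis)
  ultimately show ?thesis by (simp add: std_simplex)
qed

text \<open>The affine map exchanging the vertices 0 and \<open>axis k 1\<close> and fixing the
  others. Unlike an exchange of two coordinates, it also exists in dimension one, where it is y -> 1
  - y.\<close>

lemma std_simplex_reflection:
  obtains R :: "real^'n^'n" and b where "det R = -1" "b \<in> convex hull (insert 0 Basis)"
    "(\<lambda>y. y + b) ` (*v) R ` (convex hull (insert 0 Basis)) = convex hull (insert 0 Basis)"
proof -
  obtain k :: 'n where True by blast
  \<comment> \<open>\<open>R\<close> is the identity with row \<open>k\<close> replaced by entries
    -1. Writing that row as the one of a diagonal matrix plus a combination of the other rows gives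
    the determinant without expansion.\<close>
  define D :: "real^'n^'n" where "D = (\<chi> i j. if i = j then (if i = k then -1 else 1) else 0)"
  define w :: "real^'n" where "w = (\<Sum>j\<in>UNIV-{k}. (-1) *s row j D)"
  define R :: "real^'n^'n" where "R = (\<chi> i. if i = k then row k D + w else row i D)"
  let ?T = "convex hull (insert 0 Basis) :: (real^'n) set"
  have wj: "w $ j = (if j = k then 0 else -1)" for j
    by (simp add: w_def D_def row_def if_distrib cong: if_cong)
  have "w \<in> vec.span {row j D |j. j \<noteq> k}"
    unfolding w_def by (intro vec.span_sum vec.span_scale vec.span_base) auto
  then have "det R = det D" unfolding R_def by (rule det_row_span)
  also have "\<dots> = (\<Prod>i\<in>UNIV. if i = k then -1 else 1)"
    by (subst det_diagonal) (auto simp: D_def)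
  finally have det: "det R = -1" by simp
  have Rij: "R $ i $ j = (if i = k then -1 else if i = j then 1 else 0)" for i j
    by (auto simp: R_def wj D_def row_def)
  have Rv: "(R *v y) $ i = (if i = k then - (\<Sum>j\<in>UNIV. y $ j) else y $ i)" for y i
  proof -
    have "(if i = j then 1 else 0) * y $ j = (if i = j then y $ j else 0)" for j by simp
    then show ?thesis by (simp add: matrix_vector_mult_def Rij sum_negf)
  qed
  define b :: "real^'n" where "b = axis k 1"
  let ?f = "\<lambda>y. R *v y + b"
  have f: "?f y $ i = (if i = k then 1 - (\<Sum>j\<in>UNIV. y $ j) else y $ i)" for y i
    by (simp add: Rv b_def axis_def)
  have sf: "(\<Sum>i\<in>UNIV. ?f y $ i) = 1 - y $ k" for y
  proof -
    have "(\<Sum>i\<in>UNIV. ?f y $ i) = ?f y $ k + (\<Sum>i\<in>UNIV-{k}. ?f y $ i)"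
      by (simp add: sum.remove)
    also have "(\<Sum>i\<in>UNIV-{k}. ?f y $ i) = (\<Sum>i\<in>UNIV-{k}. y $ i)"
      by (intro sum.cong) (auto simp: f simp del: vector_add_component)
    also have "\<dots> = (\<Sum>i\<in>UNIV. y $ i) - y $ k"
      by (simp add: sum_diff1)
    finally show ?thesis by (simp add: f del: vector_add_component)
  qed
  have fT: "?f y \<in> ?T" if "y \<in> ?T" for y
    using that unfolding std_simplex_cart by (simp only: mem_Collect_eq sf) (simp add: f del: vector_add_component)
  have ff: "?f (?f y) = y" for y
    unfolding vec_eq_iff
  proof
    show "?f (?f y) $ i = y $ i" for i
      using f[of "?f y" i] f[of y i] sf[of y] by (cases "i = k") simp_all
  qed
  have "(\<lambda>y. y + b) ` (*v) R ` ?T = ?f ` ?T" by (simp add: image_image)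
  also have "\<dots> = ?T"
  proof
    show "?f ` ?T \<subseteq> ?T" using fT by blast
    show "?T \<subseteq> ?f ` ?T"
    proof
      fix y assume "y \<in> ?T"
      then show "y \<in> ?f ` ?T" using fT[of y] ff[of y] by (metis image_eqI)
    qed
  qed
  finally have im: "(\<lambda>y. y + b) ` (*v) R ` ?T = ?T" .
  have "b \<in> ?T" unfolding b_def by (intro hull_inc) (auto simp: Basis_vec_def)
  with det im show thesis using that by blast
qed

text \<open>The columns of \<open>A\<close> are the edges leaving one vertex \<open>a\<close>. If
  they are negatively oriented, the reflection of the standard simplex is applied first, which moves
  the translation vector to \<open>A *v b + a\<close>. That \<open>a\<close> stays in
  \<open>S\<close> serves later to bound both \<open>a\<close> itself and the columns of
  \<open>A\<close>.\<close>

lemma simplex_affine_image: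
  fixes S :: "(real^'n) set"
  assumes "int CARD('n) simplex S"
  obtains A :: "real^'n^'n" and a where "det A > 0" "a \<in> S"
    "S = (\<lambda>y. y + a) ` (*v) A ` (convex hull (insert 0 Basis))"
proof -
  let ?T = "convex hull (insert 0 Basis) :: (real^'n) set"
  obtain C where C: "finite C" "\<not> affine_dependent C" "int (card C) = int CARD('n) + 1" "S = convex hull C"
    using assms unfolding simplex by blast
  then obtain a where a: "a \<in> C" by fastforce
  define C' where "C' = (\<lambda>c. - a + c) ` (C - {a})"
  have "finite C'" using C(1) by (simp add: C'_def)
  have "card C' = CARD('n)"
    using C(1,3) a by (simp add: C'_def card_image inj_on_def)
  moreover have "independent C'"
    using affine_dependent_iff_dependent2[OF a] C(2) by (simp add: C'_def)
  ultimately have span: "span C' = UNIV"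
    using dim_eq_full[of C'] by (simp add: dim_eq_card_independent)
  obtain f where f: "bij_betw f (UNIV :: 'n set) C'"
    using finite_same_card_bij[of "UNIV :: 'n set" C'] \<open>finite C'\<close> \<open>card C' = CARD('n)\<close> by auto
  define A :: "real^'n^'n" where "A = (\<chi> i j. f j $ i)"
  have "A *v axis j 1 = f j" for j
    by (simp add: matrix_vector_mult_basis column_def A_def vec_eq_iff)
  then have AB: "(*v) A ` Basis = C'"
    using f by (auto simp: Basis_vec_def bij_betw_def image_image UNION_singleton_eq_range)
  have "surj ((*v) A)"
    using span linear_span_image[of "(*v) A" Basis] by (simp add: AB)
  then have "invertible A"
    by (simp add: invertible_right_inverse matrix_right_invertible_surjective)
  then have detA: "det A \<noteq> 0" by (simp add: invertible_det_nz)
  have "(*v) A ` ?T = convex hull (insert 0 C')"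
    by (simp add: convex_hull_linear_image AB)
  then have "(\<lambda>y. y + a) ` (*v) A ` ?T = (+) a ` (convex hull (insert 0 C'))"
    by (simp only: add.commute[of _ a])
  also have "\<dots> = convex hull ((+) a ` insert 0 C')"
    by (rule convex_hull_translation[symmetric])
  also have "(+) a ` insert 0 C' = C"
    using a by (auto simp: C'_def image_image)
  finally have S: "S = (\<lambda>y. y + a) ` (*v) A ` ?T" by (simp add: C(4))
  have aS: "a \<in> S" using a C(4) hull_inc by metis
  show thesis
  proof (cases "det A > 0")
    case True
    then show thesis using that aS S by blast
  next
    case False
    obtain R :: "real^'n^'n" and b where R: "det R = -1" "b \<in> ?T" "(\<lambda>y. y + b) ` (*v) R ` ?T = ?T"
      using std_simplex_reflection .
    show thesis
    proof (rule that)
      show "det (A ** R) > 0" using False detA R(1) by (simp add: det_mul)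
      show "A *v b + a \<in> S" using R(2) S by blast
      have "S = (\<lambda>y. y + a) ` (*v) A ` (\<lambda>y. y + b) ` (*v) R ` ?T" using S R(3) by simp
      then show "S = (\<lambda>y. y + (A *v b + a)) ` (*v) (A ** R) ` ?T"
        by (simp add: image_image matrix_vector_right_distrib matrix_vector_mul_assoc add.assoc)
    qed
  qed
qed

subsection \<open>Vanishing and characterization\<close>

context covariant_valuation
begin

lemma dissect:
  assumes K: "K \<in> convex_bodies" and p: "p \<in> interior K" and u: "u \<noteq> 0"
  shows "Z K x = Z (K \<inter> {y. u \<bullet> y \<le> u \<bullet> p}) x + Z (K \<inter> {y. u \<bullet> p \<le> u \<bullet> y}) x"
proof (cases "CARD('n) = 1")
  case True
  then show ?thesis
    using dissect_transversal[OF K p, of u "u /\<^sub>R (u \<bullet> u)"] u by simp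
next
  case False
  have "CARD('n) \<noteq> 0" by simp
  with False have "2 \<le> CARD('n)" by linarith
  then have "2 \<le> DIM(real^'n)" by simp
  then obtain w where w: "w \<noteq> 0" "orthogonal u w"
    using orthogonal_to_vector_exists by metis
  have transversal: "Z K x = Z (K \<inter> {y. u \<bullet> y \<le> u \<bullet> p}) x + Z (K \<inter> {y. u \<bullet> p \<le> u \<bullet> y}) x"
    if "x = c *\<^sub>R u + x'" "u \<bullet> x' = 0" "x' \<noteq> 0" for x c x'
  proof -
    \<comment> \<open>The normalised \<open>u\<close> satisfies \<open>u \<bullet> v = 1\<close>,
      and adding a multiple of \<open>x'\<close> does not change this; the factor is chosen to
      cancel the contribution \<open>c\<close> of \<open>u\<close> to
      \<open>v \<bullet> x\<close>.\<close>
    define v where "v = u /\<^sub>R (u \<bullet> u) - (c / (x' \<bullet> x')) *\<^sub>R x'"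
    have "u \<bullet> v = 1"
      using that(2) u by (simp add: v_def inner_diff_right)
    moreover have "v \<bullet> u = 1" "v \<bullet> x' = - c"
      using that(2,3) u by (simp_all add: v_def inner_diff_left inner_commute[of x' u])
    then have "v \<bullet> x = 0"
      unfolding that(1) by (simp add: inner_add_right)
    ultimately show ?thesis
      using dissect_transversal[OF K p] by blast
  qed
  define c where "c = (u \<bullet> x) / (u \<bullet> u)"
  define x' where "x' = x - c *\<^sub>R u"
  have x: "x = c *\<^sub>R u + x'" "u \<bullet> x' = 0"
    using u by (simp_all add: x'_def c_def inner_diff_right)
  show ?thesis
  proof (cases "x' = 0")
    case False
    with x transversal show ?thesis by blast
  next
    case True
    \<comment> \<open>Here \<open>x\<close> is a multiple of \<open>u\<close>, and every admissible
      \<open>v\<close> fails for \<open>x \<noteq> 0\<close>. Tilting \<open>x\<close> slightly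
      towards \<open>w\<close>, which exists in dimension at least two, makes the transversal case
      applicable.\<close>
    define t :: "nat \<Rightarrow> real" where "t = (\<lambda>i. inverse (Suc i))"
    have t: "t \<longlonglongrightarrow> 0" unfolding t_def by (rule LIMSEQ_inverse_real_of_nat)
    have "(\<lambda>i. c *\<^sub>R u + t i *\<^sub>R w) \<longlonglongrightarrow> c *\<^sub>R u + 0 *\<^sub>R w"
      by (intro tendsto_intros t)
    then have lim: "(\<lambda>i. c *\<^sub>R u + t i *\<^sub>R w) \<longlonglongrightarrow> x"
      using x True by simp
    note b = convex_bodies_Int_halfspace[OF K p u]
    have eq: "Z (K \<inter> {y. u \<bullet> y \<le> u \<bullet> p}) (c *\<^sub>R u + t i *\<^sub>R w) + Z (K \<inter> {y. u \<bullet> p \<le> u \<bullet> y}) (c *\<^sub>R u + t i *\<^sub>R w)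
        = Z K (c *\<^sub>R u + t i *\<^sub>R w)" for i
      by (rule transversal[symmetric, OF refl]) (use w in \<open>auto simp: orthogonal_def t_def\<close>)
    have "(\<lambda>i. Z K (c *\<^sub>R u + t i *\<^sub>R w))
      \<longlonglongrightarrow> Z (K \<inter> {y. u \<bullet> y \<le> u \<bullet> p}) x + Z (K \<inter> {y. u \<bullet> p \<le> u \<bullet> y}) x"
      unfolding eq[symmetric]
      by (intro tendsto_add tendsto_value[OF b(1) lim] tendsto_value[OF b(2) lim])
    then show ?thesis
      by (rule LIMSEQ_unique[OF tendsto_value[OF K lim]])
  qed
qed

text \<open>The value 0 on sets without interior agrees with the limit of Z on thin strips. With
  \<open>x\<close> fixed this is a real functional on all sets, as \<open>dissective\<close>
  requires.\<close>

definition extended :: "real^'n \<Rightarrow> (real^'n) set \<Rightarrow> real" where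
  "extended x K = (if interior K = {} then 0 else Z K x)"

lemma extended_body: "K \<in> convex_bodies \<Longrightarrow> extended x K = Z K x"
  by (simp add: extended_def convex_bodies_def)

text \<open>If the hyperplane leaves the interior of \<open>K\<close> on one side, one piece is
  \<open>K\<close> and the other has no interior. Otherwise, the interior being connected, the
  hyperplane passes through an interior point, and \<open>dissect\<close> applies.\<close>

lemma dissective_extended: "dissective (extended x)"
  unfolding dissective_def
proof (intro conjI allI impI)
  show "extended x K = 0" if "interior K = {}" for K
    using that by (simp add: extended_def)
next
  fix K :: "(real^'n) set" and u :: "real^'n" and a
  assume K: "compact K" "convex K" and u: "u \<noteq> 0"
  let ?L = "{y. u \<bullet> y \<le> a}" and ?G = "{y. a \<le> u \<bullet> y}"
  have trivial: "extended x K = extended x (K \<inter> {y. w \<bullet> y \<le> b}) + extended x (K \<inter> {y. b \<le> w \<bullet> y})"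
    if w: "w \<noteq> 0" and b: "interior K \<inter> {y. w \<bullet> y < b} = {}" for w b
  proof (cases "interior K = {}")
    case True
    then have "interior (K \<inter> X) = {}" for X by (simp add: interior_Int)
    with True show ?thesis by (simp add: extended_def)
  next
    case False
    have "closure (interior K) \<subseteq> {y. b \<le> w \<bullet> y}"
      using b by (intro closure_minimal closed_halfspace_ge) (auto simp: not_less)
    then have "K \<subseteq> {y. b \<le> w \<bullet> y}"
      using convex_closure_interior[OF K(2) False] closure_subset by blast
    moreover have "interior (K \<inter> {y. w \<bullet> y \<le> b}) = {}"
      using b interior_halfspace_le[OF w, of b] by (simp add: interior_Int)
    ultimately show ?thesis by (simp add: extended_def Int_absorb2)
  qed
  show "extended x K = extended x (K \<inter> ?L) + extended x (K \<inter> ?G)"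
  proof (cases "interior K \<inter> {y. u \<bullet> y < a} = {} \<or> interior K \<inter> {y. a < u \<bullet> y} = {}")
    case True
    then show ?thesis
      using trivial[of u a] trivial[of "-u" "-a"] u by auto
  next
    case False
    then obtain y z where "y \<in> interior K" "u \<bullet> y < a" "z \<in> interior K" "a < u \<bullet> z" by blast
    then obtain p where p: "p \<in> interior K" "u \<bullet> p = a"
      using connected_ivt_hyperplane[of "interior K" y z u a] convex_connected[OF convex_interior[OF K(2)]] by auto
    then have b: "K \<in> convex_bodies" using K by (auto simp: convex_bodies_def)
    show ?thesis
      using dissect[OF b p(1) u, of x] convex_bodies_Int_halfspace[OF b p(1) u] b
      by (simp add: extended_body p(2))
  qed
qed

end

section \<open>The Laplace transform as an instance; bodies as limits of polytopes\<close>

lemma laplace_transform_0_pos: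
  assumes "K \<in> convex_bodies"
  shows "laplace_transform K 0 > 0"
proof -
  have "K \<in> sets borel" "K \<in> lmeasurable"
    using convex_bodiesD[OF assms] by (auto simp: lmeasurable_compact)
  moreover have "\<not> negligible K"
    using convex_bodiesD(3)[OF assms] open_not_negligible[OF open_interior] negligible_subset interior_subset by metis
  ultimately have "measure lebesgue K > 0" "measure lebesgue K = measure lborel K"
    by (auto simp: negligible_iff_measure zero_less_measure_iff)
  \<comment> \<open>At the argument 0 the Laplace transform is the volume. It serves in this role
    below, for estimates over the simplices and as denominator of the constant.\<close>
  moreover have "laplace_transform K 0 = measure lborel K"
    using convex_bodiesD(1)[OF assms] by (simp add: laplace_transform_def set_lebesgue_integral_def emeasure_compact_finite)
  ultimately show ?thesis by simp
qed

lemma covariant_valuation_laplace_transform: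
  "covariant_valuation (laplace_transform :: (real^'n) set \<Rightarrow> _)"
proof
  show "continuous_on UNIV (laplace_transform K)" if "K \<in> convex_bodies" for K :: "(real^'n) set"
    using that continuous_laplace_transform convex_bodiesD(1) by blast
  show "hausdorff_continuous (laplace_transform :: (real^'n) set \<Rightarrow> _)"
    unfolding hausdorff_continuous_def using laplace_transform_tendsto by blast
  show "positively_GL_covariant (laplace_transform :: (real^'n) set \<Rightarrow> _)"
    unfolding positively_GL_covariant_def using laplace_transform_matrix_image convex_bodiesD(1) by blast
  show "log_translation_covariant (laplace_transform :: (real^'n) set \<Rightarrow> _)"
    unfolding log_translation_covariant_def using laplace_transform_translation convex_bodiesD(1) by blast
  show "valuation (laplace_transform :: (real^'n) set \<Rightarrow> _)"
    unfolding valuation_def using laplace_transform_valuation convex_bodiesD(1) by blast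
qed

lemma std_simplex_body: "convex hull (insert 0 Basis) \<in> (convex_bodies :: 'a::euclidean_space set set)"
proof -
  obtain a :: 'a where "a \<in> interior (convex hull (insert 0 Basis))"
    by (rule interior_std_simplex_nonempty)
  then show ?thesis
    by (auto simp: convex_bodies_def intro!: finite_imp_compact_convex_hull)
qed

text \<open>The hulls of longer and longer initial parts of a dense sequence in \<open>K\<close>
  exhaust it; adding the vertices \<open>V\<close> of a fixed box inside \<open>K\<close> gives
  every hull an interior.\<close>

lemma polytope_convex_body_approximation:
  fixes K :: "'a::euclidean_space set"
  assumes K: "K \<in> convex_bodies"
  obtains P where "\<And>i::nat. polytope (P i)" "\<And>i. P i \<in> convex_bodies"
    "(\<lambda>i. hausdorff_dist (P i) K) \<longlonglongrightarrow> 0"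
proof -
  note K' = convex_bodiesD[OF K]
  obtain p where "p \<in> interior K" using K' by blast
  then obtain a b where ab: "p \<in> box a b" "cbox a b \<subseteq> interior K"
    using open_contains_cbox[OF open_interior] by metis
  obtain V where V: "finite V" "cbox a b = convex hull V"
    using polytope_interval[of a b] unfolding polytope_def by blast
  obtain D where D: "countable D" "D \<subseteq> K" "K \<subseteq> closure D"
    using separable .
  have "D \<noteq> {}" using D(3) K'(6) by auto
  define P where "P i = convex hull (V \<union> from_nat_into D ` {..i})" for i :: nat
  have "V \<subseteq> K" using V ab interior_subset hull_subset[of V convex] by blast
  then have PK: "P i \<subseteq> K" for i
    unfolding P_def using D(2) from_nat_into[OF \<open>D \<noteq> {}\<close>] K'(2) by (intro hull_minimal) auto
  show thesis
  proof (rule that)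
    show "polytope (P i)" for i
      unfolding P_def using V(1) by (intro polytope_convex_hull) simp
    have "cbox a b \<subseteq> P i" for i
      unfolding V(2) P_def by (intro hull_mono) auto
    from interior_mono[OF this] have "box a b \<subseteq> interior (P i)" for i
      by simp
    then have "interior (P i) \<noteq> {}" for i using ab(1) by blast
    then show "P i \<in> convex_bodies" for i
      using V(1) by (auto simp: convex_bodies_def P_def intro: finite_imp_compact_convex_hull)
    show "(\<lambda>i. hausdorff_dist (P i) K) \<longlonglongrightarrow> 0"
    proof (rule hausdorff_dist_tendsto_0[where D = D and B = K])
      show "\<forall>\<^sub>F i in sequentially. y \<in> P i" if "y \<in> D" for y
      proof -
        obtain n where "from_nat_into D n = y"
          using from_nat_into_surj[OF D(1) \<open>y \<in> D\<close>] by blast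
        then have "y \<in> P i" if "n \<le> i" for i
          unfolding P_def using that by (intro hull_inc) auto
        then show ?thesis unfolding eventually_sequentially by blast
      qed
      show "l \<in> K" if "strict_mono (r :: nat \<Rightarrow> nat)" "\<And>i. y i \<in> P (r i)" "y \<longlonglongrightarrow> l" for r y l
        using closed_sequentially[OF K'(4) _ that(3)] that(2) PK by blast
    qed (use PK K' D in auto)
  qed
qed

context covariant_valuation
begin

lemma vanish_on_polytope:
  assumes T: "Z (convex hull (insert 0 Basis)) 0 = 0"
    and P: "P \<in> convex_bodies" "polytope P"
  shows "Z P x = 0"
proof -
  interpret L: covariant_valuation "laplace_transform :: (real^'n) set \<Rightarrow> _"
    by (rule covariant_valuation_laplace_transform)
  let ?T = "convex hull (insert 0 Basis) :: (real^'n) set"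
  let ?n = "CARD('n)"
  obtain R where R: "\<And>y. y \<in> P \<Longrightarrow> norm y \<le> R"
    using convex_bodiesD(5)[OF P(1)] by (auto simp: bounded_iff)
  \<comment> \<open>The numerator bounds the factor \<open>exp (- (a \<bullet> x))\<close> for
    \<open>a\<close> in \<open>P\<close>. The denominator, the volume of the standard simplex, turns
    \<open>det A\<close> into the volume of the simplex, and these volumes add up to that of
    \<open>P\<close>.\<close>
  define C where "C = exp (R * norm x) / laplace_transform ?T 0"
  have LT: "laplace_transform ?T 0 > 0"
    by (rule laplace_transform_0_pos[OF std_simplex_body])
  have "C \<ge> 0" using LT by (simp add: C_def)
  have bound: "\<bar>Z P x\<bar> \<le> C * laplace_transform P 0 * h" if "h > 0" for h
  proof -
    have "isCont (Z ?T) 0"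
      using continuous_value[OF std_simplex_body] by (simp add: continuous_on_eq_continuous_at)
    then obtain d where d: "d > 0" "\<And>y. norm y < d \<Longrightarrow> \<bar>Z ?T y\<bar> < h"
      using \<open>h > 0\<close> T by (auto simp: continuous_at_eps_delta dist_norm)
    \<comment> \<open>Each of the n coordinates of A^t x will be at most \<open>e * norm x\<close>
      in absolute value, so its norm is at most their sum, which is below \<open>d\<close>. The 1 in
      the denominator covers \<open>x = 0\<close>.\<close>
    define e where "e = d / (1 + ?n * norm x)"
    have "e > 0" using d(1) by (simp add: e_def add_pos_nonneg)
    have e: "?n * (e * norm x) < d"
    proof -
      have "d * (?n * norm x) < d * (1 + ?n * norm x)" using d(1) by simp
      moreover have "0 < 1 + ?n * norm x" by (simp add: add_pos_nonneg)
      ultimately show ?thesis by (simp add: e_def field_simps)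
    qed
    have aP: "aff_dim P = ?n"
      using convex_bodiesD(3)[OF P(1)] aff_dim_nonempty_interior[of P] by simp
    have "\<exists>J. triangulation J \<and> (\<forall>k\<in>J. diameter k < e) \<and> (\<forall>k\<in>J. aff_dim k = ?n) \<and> \<Union>J = \<Union>{P}"
    proof (rule fine_triangular_subdivision_of_cell_complex[OF \<open>e > 0\<close>, of "{P}" "int ?n"])
      show "C1 \<inter> C2 face_of C1" if "C1 \<in> {P}" "C2 \<in> {P}" for C1 C2
        using that P(2) by (simp add: polytope_imp_convex face_of_refl)
    qed (use P(2) aP in blast)+
    then obtain J where J: "triangulation J" "\<And>k. k \<in> J \<Longrightarrow> diameter k < e"
        "\<And>k. k \<in> J \<Longrightarrow> aff_dim k = ?n" "\<Union>J = P"
      by auto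
    have fin: "finite J" and splx: "\<And>S. S \<in> J \<Longrightarrow> \<exists>n. n simplex S"
      and face: "\<And>S S'. S \<in> J \<Longrightarrow> S' \<in> J \<Longrightarrow> S \<inter> S' face_of S"
      using J(1) by (auto simp: triangulation_def)
    have sx: "int ?n simplex S" if "S \<in> J" for S
    proof -
      have "\<exists>n. n simplex S" by (rule splx[OF that])
      then obtain n where "n simplex S" ..
      then show ?thesis using aff_dim_simplex[of n S] J(3)[OF that] by simp
    qed
    have poly: "polytope S" if "S \<in> J" for S
      using sx[OF that] simplex_imp_polytope by blast
    \<comment> \<open>The intersection of two cells is a face of both. If it had interior, it would
      be a face of full dimension, hence equal to each of them.\<close>
    have disj: "interior (S \<inter> S') = {}" if "S \<in> J" "S' \<in> J" "S \<noteq> S'" for S S'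
    proof (rule ccontr)
      assume "interior (S \<inter> S') \<noteq> {}"
      then have ad: "aff_dim (S \<inter> S') = ?n" using aff_dim_nonempty_interior[of "S \<inter> S'"] by simp
      have "X \<subseteq> Y" if "X \<in> J" "Y \<in> J" "aff_dim (X \<inter> Y) = ?n" for X Y
      proof -
        have "X \<inter> Y = X"
          using face_of_aff_dim_lt[OF polytope_imp_convex[OF poly[OF that(1)]] face[OF that(1,2)]]
            J(3)[OF that(1)] that(3) by auto
        then show ?thesis by blast
      qed
      from this[OF that(1,2) ad] this[OF that(2,1)] ad that(3) show False
        by (simp add: Int_commute)
    qed
    have sum: "f P = (\<Sum>S\<in>J. f S)" if "dissective f" for f :: "_ \<Rightarrow> real"
      using dissective_sum[OF that fin poly disj _ _ J(4)[symmetric]] convex_bodiesD[OF P(1)] by blast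
    have body: "S \<in> convex_bodies" if "S \<in> J" for S
    proof -
      obtain A :: "real^'n^'n" and a where A: "det A > 0" "S = (\<lambda>y. y + a) ` (*v) A ` ?T"
        by (rule simplex_affine_image[OF sx[OF \<open>S \<in> J\<close>]])
      then show ?thesis
        using convex_bodies_translation[OF convex_bodies_matrix_image[OF std_simplex_body, of A], of a]
        by (simp add: invertible_det_nz)
    qed
    have S: "\<bar>Z S x\<bar> \<le> C * h * laplace_transform S 0" if "S \<in> J" for S
    proof -
      obtain A :: "real^'n^'n" and a where A: "det A > 0" "a \<in> S" "S = (\<lambda>y. y + a) ` (*v) A ` ?T"
        by (rule simplex_affine_image[OF sx[OF \<open>S \<in> J\<close>]])
      have inv: "invertible A" using A(1) by (simp add: invertible_det_nz)
      note AT = convex_bodies_matrix_image[OF std_simplex_body inv]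
      \<comment> \<open>A column of \<open>A\<close> is the difference of two points of
        \<open>S\<close>, the translated vertex \<open>A *v axis i 1 + a\<close> and
        \<open>a\<close>, so the diameter bounds it.\<close>
      have col: "norm (A *v axis i 1) \<le> e" for i
      proof -
        have "(axis i 1 :: real^'n) \<in> ?T" by (intro hull_inc) (auto simp: Basis_vec_def)
        then have "A *v axis i 1 + a \<in> S" using A(3) by blast
        then have "norm (A *v axis i 1) \<le> diameter S"
          using diameter_bounded_bound[OF convex_bodiesD(5)[OF body[OF that]] _ A(2)]
          by (force simp: dist_norm)
        then show ?thesis using J(2)[OF that] by simp
      qed
      have "norm (transpose A *v x) \<le> (\<Sum>i\<in>UNIV. \<bar>(transpose A *v x) $ i\<bar>)"
        by (rule norm_le_l1_cart)
      also have "\<dots> \<le> (\<Sum>i\<in>(UNIV :: 'n set). e * norm x)"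
      proof (rule sum_mono)
        fix i
        have "(transpose A *v x) $ i = x \<bullet> (A *v axis i 1)"
          by (simp add: dot_lmul_matrix[symmetric] inner_axis)
        also have "\<bar>\<dots>\<bar> \<le> norm x * norm (A *v axis i 1)" by (rule Cauchy_Schwarz_ineq2)
        also have "\<dots> \<le> e * norm x" using mult_right_mono[OF col[of i] norm_ge_zero[of x]] by (simp only: mult.commute)
        finally show "\<bar>(transpose A *v x) $ i\<bar> \<le> e * norm x" .
      qed
      finally have "norm (transpose A *v x) < d" using e by simp
      then have g: "\<bar>Z ?T (transpose A *v x)\<bar> < h" by (rule d(2))
      have vol: "laplace_transform S 0 = det A * laplace_transform ?T 0"
        unfolding A(3) using L.affine_image[OF std_simplex_body inv A(1) AT, of a 0] by simp
      have "- (a \<bullet> x) \<le> norm a * norm x"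
        using Cauchy_Schwarz_ineq2[of a x] by linarith
      also have "\<dots> \<le> R * norm x"
        using A(2) that J(4) by (intro mult_right_mono R) auto
      finally have "exp (- (a \<bullet> x)) \<le> exp (R * norm x)" by simp
      then have "exp (- (a \<bullet> x)) * (det A * \<bar>Z ?T (transpose A *v x)\<bar>) \<le> exp (R * norm x) * (det A * h)"
        using g A(1) by (intro mult_mono) (auto intro: less_imp_le)
      moreover have "\<bar>Z S x\<bar> = exp (- (a \<bullet> x)) * (det A * \<bar>Z ?T (transpose A *v x)\<bar>)"
        unfolding A(3) affine_image[OF std_simplex_body inv A(1) AT] using A(1) by (simp add: abs_mult)
      ultimately show ?thesis
        using LT by (simp add: vol C_def mult.commute[of h])
    qed
    have "\<bar>Z P x\<bar> = \<bar>\<Sum>S\<in>J. Z S x\<bar>"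
      using sum[OF dissective_extended[of x]] extended_body body P(1) by simp
    also have "\<dots> \<le> (\<Sum>S\<in>J. \<bar>Z S x\<bar>)" by (rule sum_abs)
    also have "\<dots> \<le> (\<Sum>S\<in>J. C * h * laplace_transform S 0)" by (intro sum_mono S)
    also have "\<dots> = C * h * laplace_transform P 0"
      using sum[OF L.dissective_extended[of 0]] L.extended_body body P(1) by (simp add: sum_distrib_left)
    finally show ?thesis by (simp add: mult_ac)
  qed
  have "\<bar>Z P x\<bar> \<le> 0"
  proof (rule field_le_epsilon)
    fix h :: real assume "h > 0"
    \<comment> \<open>Applying \<open>bound\<close> to \<open>h / ?D\<close> leaves at most
      \<open>h\<close>; the summand 1 keeps the divisor positive.\<close>
    let ?D = "C * laplace_transform P 0 + 1"
    have D: "?D > 0"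
      using \<open>C \<ge> 0\<close> laplace_transform_0_pos[OF P(1)] by (simp add: add_nonneg_pos)
    have "\<bar>Z P x\<bar> \<le> C * laplace_transform P 0 * (h / ?D)"
      using D \<open>h > 0\<close> by (intro bound) simp
    also have "\<dots> \<le> ?D * (h / ?D)"
      using D \<open>h > 0\<close> by (intro mult_right_mono) auto
    finally show "\<bar>Z P x\<bar> \<le> 0 + h" using D by simp
  qed
  then show ?thesis by simp
qed

lemma vanish:
  assumes "Z (convex hull (insert 0 Basis)) 0 = 0" and K: "K \<in> convex_bodies"
  shows "Z K x = 0"
proof -
  obtain P where P: "\<And>i::nat. polytope (P i)" "\<And>i. P i \<in> convex_bodies"
    "(\<lambda>i. hausdorff_dist (P i) K) \<longlonglongrightarrow> 0"
    by (rule polytope_convex_body_approximation[OF K]) (rule that)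
  have "(\<lambda>i. Z (P i) x) \<longlonglongrightarrow> Z K x"
    by (rule tendsto_body[OF P(2) K P(3)])
  moreover have "Z (P i) x = 0" for i
    by (rule vanish_on_polytope[OF assms(1) P(2,1)])
  ultimately show ?thesis by (simp add: LIMSEQ_const_iff)
qed

lemma add_multiple:
  assumes "covariant_valuation Y"
  shows "covariant_valuation (\<lambda>K x. Z K x + c * Y K x)"
proof
  interpret Y: covariant_valuation Y by fact
  let ?W = "\<lambda>K x. Z K x + c * Y K x"
  show "continuous_on UNIV (?W K)" if "K \<in> convex_bodies" for K
    by (intro continuous_intros continuous_value Y.continuous_value that)
  show "hausdorff_continuous ?W"
    unfolding hausdorff_continuous_def by (intro allI impI tendsto_intros tendsto_body Y.tendsto_body) auto
  show "positively_GL_covariant ?W"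
    using GL_covariant Y.GL_covariant
    by (simp add: positively_GL_covariant_def algebra_simps del: transpose_matrix_vector)
  show "log_translation_covariant ?W"
    using translation_covariant Y.translation_covariant
    by (simp add: log_translation_covariant_def algebra_simps)
  show "valuation ?W"
    unfolding valuation_def
  proof (intro allI impI)
    fix K L :: "(real^'n) set" and x
    assume *: "K \<in> convex_bodies" "L \<in> convex_bodies" "K \<union> L \<in> convex_bodies" "K \<inter> L \<in> convex_bodies"
    have "Z (K \<union> L) x + Z (K \<inter> L) x = Z K x + Z L x" "Y (K \<union> L) x + Y (K \<inter> L) x = Y K x + Y L x"
      using valuation Y.valuation * by (auto simp: valuation_def)
    then have "(Z (K \<union> L) x + Z (K \<inter> L) x) + c * (Y (K \<union> L) x + Y (K \<inter> L) x)
        = (Z K x + Z L x) + c * (Y K x + Y L x)" by simp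
    then show "?W (K \<union> L) x + ?W (K \<inter> L) x = ?W K x + ?W L x"
      by (simp add: algebra_simps)
  qed
qed

lemma eq_multiple_laplace_transform:
  "\<exists>c. \<forall>K\<in>convex_bodies. Z K = (\<lambda>x. c * laplace_transform K x)"
proof -
  let ?T = "convex hull (insert 0 Basis) :: (real^'n) set"
  define c where "c = Z ?T 0 / laplace_transform ?T 0"
  interpret W: covariant_valuation "\<lambda>K x. Z K x + (- c) * laplace_transform K x"
    by (rule add_multiple[OF covariant_valuation_laplace_transform])
  have "laplace_transform ?T 0 \<noteq> 0"
    using laplace_transform_0_pos[OF std_simplex_body] by (metis less_irrefl)
  then have "Z ?T 0 + (- c) * laplace_transform ?T 0 = 0"
    by (simp add: c_def)
  from W.vanish[OF this] show ?thesis by (intro exI[of _ c]) auto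
qed

end

theorem theorem1p2:
  fixes Z :: "(real ^ 'n) set \<Rightarrow> real ^ 'n \<Rightarrow> real"
  assumes "Z \<in> convex_bodies \<rightarrow> {f. continuous_on UNIV f}"
  shows "hausdorff_continuous Z \<and> positively_GL_covariant Z \<and>
           log_translation_covariant Z \<and> valuation Z
         \<longleftrightarrow> (\<exists>c::real. \<forall>K\<in>convex_bodies. Z K = (\<lambda>x. c * laplace_transform K x))"
proof
  assume "hausdorff_continuous Z \<and> positively_GL_covariant Z \<and> log_translation_covariant Z \<and> valuation Z"
  with assms have "covariant_valuation Z"
    by (auto simp: covariant_valuation_def)
  then show "\<exists>c. \<forall>K\<in>convex_bodies. Z K = (\<lambda>x. c * laplace_transform K x)"
    by (rule covariant_valuation.eq_multiple_laplace_transform)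
next
  assume "\<exists>c. \<forall>K\<in>convex_bodies. Z K = (\<lambda>x. c * laplace_transform K x)"
  then obtain c where c: "\<forall>K\<in>convex_bodies. Z K = (\<lambda>x. c * laplace_transform K x)" by blast
  then have Z: "Z K x = c * laplace_transform K x" if "K \<in> convex_bodies" for K x
    using that by simp
  interpret L: covariant_valuation "laplace_transform :: (real^'n) set \<Rightarrow> _"
    by (rule covariant_valuation_laplace_transform)
  have "hausdorff_continuous Z"
    unfolding hausdorff_continuous_def
  proof (intro allI impI)
    fix x and Ks :: "nat \<Rightarrow> (real^'n) set" and K
    assume *: "\<forall>i. Ks i \<in> convex_bodies" "K \<in> convex_bodies" "(\<lambda>i. hausdorff_dist (Ks i) K) \<longlonglongrightarrow> 0"
    then have "(\<lambda>i. c * laplace_transform (Ks i) x) \<longlonglongrightarrow> c * laplace_transform K x"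
      by (intro tendsto_intros L.tendsto_body) auto
    then show "(\<lambda>i. Z (Ks i) x) \<longlonglongrightarrow> Z K x" using * Z by simp
  qed
  \<comment> \<open>The formula for Z is known on convex bodies only, so the images under matrices
    and translations must be seen to be bodies before it can be applied to them.\<close>
  moreover have "positively_GL_covariant Z"
    using L.GL_covariant
    by (simp add: positively_GL_covariant_def Z convex_bodies_matrix_image del: transpose_matrix_vector)
  moreover have "log_translation_covariant Z"
    using L.translation_covariant
    by (simp add: log_translation_covariant_def Z convex_bodies_translation)
  moreover have "valuation Z"
    using L.valuation by (simp add: valuation_def Z distrib_left[symmetric])
  ultimately show "hausdorff_continuous Z \<and> positively_GL_covariant Z \<and> log_translation_covariant Z \<and> valuation Z"
    by blast
qed

end
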